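(* For every even integer $n\ge 8$ there exists a $3$-connected nonplanar cubic graph $G$ with $n$ vertices and exactly $2$ edge-Kempe equivalence classes of proper $3$-edge colorings, i.e. $K'(G,3)=2$.
   Context: A proper $3$-edge coloring assigns colors from $\{1,2,3\}$ to edges so that adjacent edges receive different colors. For colors $a\neq b$, an edge-Kempe chain is a connected component of the subgraph of edges colored $a$ or $b$; an edge-Kempe switch interchanges $a$ and $b$ on one chain. $K'(G,3)$ is the number of equivalence classes of proper $3$-edge colorings of $G$ under the equivalence relation generated by edge-Kempe switches. *)

theory Defs
  imports "HOL-Analysis.Analysis"
begin

definition simple_graph :: "'v set \<Rightarrow> 'v set set \<Rightarrow> bool" where
  "simple_graph V E \<longleftrightarrow> finite V \<and> (\<forall>e\<in>E. e \<subseteq> V \<and> card e = 2)"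

definition degree :: "'v set set \<Rightarrow> 'v \<Rightarrow> nat" where
  "degree E v = card {e\<in>E. v \<in> e}"

definition cubic :: "'v set \<Rightarrow> 'v set set \<Rightarrow> bool" where
  "cubic V E \<longleftrightarrow> (\<forall>v\<in>V. degree E v = 3)"

definition adj_avoiding :: "'v set set \<Rightarrow> 'v set \<Rightarrow> 'v \<Rightarrow> 'v \<Rightarrow> bool" where
  "adj_avoiding E S u w \<longleftrightarrow> {u, w} \<in> E \<and> u \<notin> S \<and> w \<notin> S"

definition connected_minus :: "'v set \<Rightarrow> 'v set set \<Rightarrow> 'v set \<Rightarrow> bool" where
  "connected_minus V E S \<longleftrightarrow> V - S \<noteq> {} \<and>
     (\<forall>u\<in>V - S. \<forall>w\<in>V - S. (adj_avoiding E S)\<^sup>*\<^sup>* u w)"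

definition k_connected :: "nat \<Rightarrow> 'v set \<Rightarrow> 'v set set \<Rightarrow> bool" where
  "k_connected k V E \<longleftrightarrow> card V > k \<and>
     (\<forall>S. S \<subseteq> V \<and> card S < k \<longrightarrow> connected_minus V E S)"

definition planar :: "'v set \<Rightarrow> 'v set set \<Rightarrow> bool" where
  "planar V E \<longleftrightarrow> (\<exists>(p :: 'v \<Rightarrow> real^2) (\<gamma> :: 'v set \<Rightarrow> real \<Rightarrow> real^2).
      inj_on p V \<and>
      (\<forall>e\<in>E. arc (\<gamma> e) \<and> {pathstart (\<gamma> e), pathfinish (\<gamma> e)} = p ` e) \<and>
      (\<forall>e\<in>E. \<forall>f\<in>E. e \<noteq> f \<longrightarrow> path_image (\<gamma> e) \<inter> path_image (\<gamma> f) \<subseteq> p ` (e \<inter> f)) \<and>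
      (\<forall>e\<in>E. \<forall>v\<in>V. p v \<in> path_image (\<gamma> e) \<longrightarrow> v \<in> e))"

definition proper_3_edge_colorings :: "'v set set \<Rightarrow> ('v set \<Rightarrow> nat) set" where
  "proper_3_edge_colorings E = {c. (\<forall>e\<in>E. c e \<in> {1,2,3}) \<and> (\<forall>e. e \<notin> E \<longrightarrow> c e = 0) \<and>
      (\<forall>e\<in>E. \<forall>f\<in>E. e \<noteq> f \<and> e \<inter> f \<noteq> {} \<longrightarrow> c e \<noteq> c f)}"

definition ab_edges :: "'v set set \<Rightarrow> ('v set \<Rightarrow> nat) \<Rightarrow> nat \<Rightarrow> nat \<Rightarrow> 'v set set" where
  "ab_edges E c a b = {e\<in>E. c e = a \<or> c e = b}"

definition ab_adj :: "'v set set \<Rightarrow> ('v set \<Rightarrow> nat) \<Rightarrow> nat \<Rightarrow> nat \<Rightarrow> 'v set \<Rightarrow> 'v set \<Rightarrow> bool" where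
  "ab_adj E c a b e f \<longleftrightarrow> e \<in> ab_edges E c a b \<and> f \<in> ab_edges E c a b \<and> e \<inter> f \<noteq> {}"

definition kempe_chain :: "'v set set \<Rightarrow> ('v set \<Rightarrow> nat) \<Rightarrow> nat \<Rightarrow> nat \<Rightarrow> 'v set \<Rightarrow> 'v set set" where
  "kempe_chain E c a b e0 = {f. (ab_adj E c a b)\<^sup>*\<^sup>* e0 f \<and> f \<in> ab_edges E c a b}"

definition swap_colors :: "nat \<Rightarrow> nat \<Rightarrow> nat \<Rightarrow> nat" where
  "swap_colors a b x = (if x = a then b else if x = b then a else x)"

definition kempe_switch :: "('v set \<Rightarrow> nat) \<Rightarrow> nat \<Rightarrow> nat \<Rightarrow> 'v set set \<Rightarrow> ('v set \<Rightarrow> nat)" where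
  "kempe_switch c a b K = (\<lambda>e. if e \<in> K then swap_colors a b (c e) else c e)"

definition kempe_step :: "'v set set \<Rightarrow> (('v set \<Rightarrow> nat) \<times> ('v set \<Rightarrow> nat)) set" where
  "kempe_step E = {(c, d). c \<in> proper_3_edge_colorings E \<and>
      (\<exists>a b e0. a \<in> {1,2,3} \<and> b \<in> {1,2,3} \<and> a \<noteq> b \<and> e0 \<in> ab_edges E c a b \<and>
         d = kempe_switch c a b (kempe_chain E c a b e0))}"

definition kempe_equiv :: "'v set set \<Rightarrow> (('v set \<Rightarrow> nat) \<times> ('v set \<Rightarrow> nat)) set" where
  "kempe_equiv E = {(c, d). c \<in> proper_3_edge_colorings E \<and> d \<in> proper_3_edge_colorings E \<and>
      (c, d) \<in> (kempe_step E \<union> (kempe_step E)\<inverse>)\<^sup>*}"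

definition edge_kempe_classes :: "'v set set \<Rightarrow> nat" where
  "edge_kempe_classes E = card (proper_3_edge_colorings E // kempe_equiv E)"

end

theory Submission
  imports Defs
begin

text \<open>Start from \<open>K\<^bsub>3,3\<^esub>\<close> and repeatedly replace a vertex by a triangle. In \<open>K\<^bsub>3,3\<^esub>\<close> any two color
  classes of a proper 3-edge-coloring form a Hamiltonian cycle, so a Kempe switch merely renames
  colors and the Kempe classes are the colorings up to renaming: the two Latin squares of order 3.
  Around a new triangle the three outgoing edges get distinct colors and each triangle edge gets the
  color of the opposite outgoing edge. Hence colorings correspond bijectively before and after the
  replacement, and two-colored cycles stay connected.

  Nonplanarity survives because deleting one triangle edge and suppressing the two vertices of degree 2
  returns the old graph. For \<open>K\<^bsub>3,3\<^esub>\<close> itself, two vertices of one side together with the other side span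
  a theta curve, and the sixth vertex would lie in a face whose closure meets all three open arcs.\<close>

subsection \<open>Theta curves\<close>

text \<open>The statement \<open>K' = 2\<close> is not what the induction carries. A switch acts on
  one chain, so as soon as some two-colored subgraph splits into several chains, switching one of
  them need not be a renaming. The invariant therefore asks that every two-colored subgraph of every
  proper coloring be connected. Kempe classes are then the orbits of the symmetric group on the
  colors, a notion free of chains, and such orbits can be compared across the triangle replacement
  through a bijection of colorings. \<open>K'\<close> itself is computed only at the very end.

  On the topological side, drawings use arbitrary arcs, so nonplanarity is drawn from Jordan-curve
  separation and not from counting faces. The known splitting of a theta curve concerns the bounded
  side of a closed curve, while the sixth vertex may lie on the unbounded side; this is why an
  inversion enters.\<close>

lemma connected_touching_arc_inside:
  fixes c :: "real \<Rightarrow> 'a::real_normed_vector"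
  assumes "connected F" "F \<noteq> {}" "F \<inter> K = {}"
    and "arc c" "path_image c \<inter> K \<subseteq> {pathstart c, pathfinish c}"
    and a: "a \<in> closure F" "a \<in> path_image c - {pathstart c, pathfinish c}"
    and meets: "(F \<union> (path_image c - {pathstart c, pathfinish c})) \<inter> inside K \<noteq> {}"
  shows "F \<union> (path_image c - {pathstart c, pathfinish c}) \<subseteq> inside K"
proof -
  \<comment> \<open>The open arc need not meet \<open>F\<close>. Adding the limit point
    \<open>a\<close> keeps \<open>F\<close> connected and provides the point at which
    \<open>F\<close> and the arc are glued into one connected set off \<open>K\<close>.\<close>
  let ?X = "insert a F \<union> (path_image c - {pathstart c, pathfinish c})"
  have "connected (insert a F)"
    using \<open>connected F\<close> by (rule connected_intermediate_closure) (use a closure_subset in auto)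
  then have "connected ?X"
    using a \<open>arc c\<close> by (intro connected_Un connected_simple_path_endless arc_imp_simple_path) auto
  moreover have "?X \<subseteq> - K"
    using assms by blast
  ultimately have "connected_component (- K) x y" if "x \<in> ?X" "y \<in> ?X" for x y
    using that unfolding connected_component_def by blast
  moreover obtain x where "x \<in> ?X" "x \<in> inside K"
    using meets by blast
  ultimately show ?thesis
    using inside_same_component by blast
qed

text \<open>The open arc of \<open>c3\<close> is attached to \<open>F\<close>, so it runs inside
  \<open>c1 \<union> c2\<close> and cuts this inside into two regions, each bounded by
  \<open>c3\<close> and just one of the other arcs. \<open>F\<close> lies in one region and touches
  the arc missing from its boundary. That arc would be dragged into the inside of
  \<open>c1 \<union> c2\<close>, a curve to which it belongs.\<close>

lemma theta_inside_face:
  fixes c1 c2 c3 :: "real \<Rightarrow> complex"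
  assumes arcs: "arc c1" "arc c2" "arc c3"
    and start: "pathstart c1 = P" "pathstart c2 = P" "pathstart c3 = P"
    and finish: "pathfinish c1 = Q" "pathfinish c2 = Q" "pathfinish c3 = Q"
    and c12: "path_image c1 \<inter> path_image c2 = {P, Q}"
    and c13: "path_image c1 \<inter> path_image c3 = {P, Q}"
    and c23: "path_image c2 \<inter> path_image c3 = {P, Q}"
    and F: "connected F" "F \<inter> (path_image c1 \<union> path_image c2 \<union> path_image c3) = {}"
    and a1: "a1 \<in> closure F" "a1 \<in> path_image c1 - {P, Q}"
    and a2: "a2 \<in> closure F" "a2 \<in> path_image c2 - {P, Q}"
    and a3: "a3 \<in> closure F" "a3 \<in> path_image c3 - {P, Q}"
    and meets: "F \<inter> inside (path_image c1 \<union> path_image c2) \<noteq> {}"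
  shows False
proof -
  have F0: "F \<noteq> {}" using meets by blast
  have "P \<noteq> Q" using arcs start finish arc_distinct_ends by metis
  have sub: "F \<union> (path_image c3 - {P, Q}) \<subseteq> inside (path_image c1 \<union> path_image c2)"
    using connected_touching_arc_inside[of F "path_image c1 \<union> path_image c2" c3 a3]
      F F0 arcs start finish a3 meets c13 c23 by auto
  then have ne: "path_image c3 \<inter> inside (path_image c1 \<union> path_image c2) \<noteq> {}"
    using a3 by blast
  have split: "inside (path_image c1 \<union> path_image c3) \<union> inside (path_image c2 \<union> path_image c3) \<union>
      (path_image c3 - {P, Q}) = inside (path_image c1 \<union> path_image c2)"
    using split_inside_simple_closed_curve[OF arc_imp_simple_path[OF arcs(1)] start(1) finish(1)
        arc_imp_simple_path[OF arcs(2)] start(2) finish(2)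
        arc_imp_simple_path[OF arcs(3)] start(3) finish(3) \<open>P \<noteq> Q\<close> c12 c13 c23 ne] by metis
  obtain x where x: "x \<in> F" using F0 by blast
  then have "x \<in> inside (path_image c1 \<union> path_image c2)" "x \<notin> path_image c3"
    using sub F by auto
  then consider "x \<in> inside (path_image c1 \<union> path_image c3)" | "x \<in> inside (path_image c2 \<union> path_image c3)"
    using split by blast
  then show False
  proof cases
    case 1
    then have "F \<union> (path_image c2 - {P, Q}) \<subseteq> inside (path_image c1 \<union> path_image c3)"
      using connected_touching_arc_inside[of F "path_image c1 \<union> path_image c3" c2 a2]
        F F0 arcs start finish a2 x c12 c23 by auto
    then have "a2 \<in> inside (path_image c1 \<union> path_image c2)"
      using a2 split by blast
    then show False using a2 inside_no_overlap by blast
  next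
    case 2
    then have "F \<union> (path_image c1 - {P, Q}) \<subseteq> inside (path_image c2 \<union> path_image c3)"
      using connected_touching_arc_inside[of F "path_image c2 \<union> path_image c3" c1 a1]
        F F0 arcs start finish a1 x c12 c13 by auto
    then have "a1 \<in> inside (path_image c1 \<union> path_image c2)"
      using a1 split by blast
    then show False using a1 inside_no_overlap by blast
  qed
qed

text \<open>The component of the inverted point, pulled back, stays outside \<open>K\<close> and
  hence away from a ball around \<open>w\<close>. Under inversion, distance from \<open>w\<close>
  becomes a bound on the norm.\<close>

lemma inversion_outside_to_inside:
  fixes K :: "complex set"
  assumes "compact K" "w \<in> inside K" "d \<in> outside K"
  shows "inverse (d - w) \<in> inside ((\<lambda>z. inverse (z - w)) ` K)"
proof -
  let ?f = "\<lambda>z. inverse (z - w)"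
  let ?g = "\<lambda>u. inverse u + w"
  have wK: "w \<notin> K" and dK: "d \<notin> K" and dw: "d \<noteq> w"
    using assms inside_no_overlap outside_no_overlap inside_Int_outside by blast+
  have gf: "?g (?f z) = z" for z by simp
  have fdK: "?f d \<notin> ?f ` K"
    using dK gf by (metis (mono_tags, lifting) imageE)
  have "compact (?f ` K)"
    using \<open>compact K\<close> wK by (intro compact_continuous_image continuous_intros) auto
  define C where "C = connected_component_set (- (?f ` K)) (?f d)"
  have "open C"
    unfolding C_def using \<open>compact (?f ` K)\<close> by (intro open_connected_component) (simp add: compact_imp_closed open_Compl)
  \<comment> \<open>\<open>0\<close> corresponds to infinity and \<open>?g\<close> is not continuous
    there. An open connected planar set stays connected without one point.\<close>
  then have "connected (C - {0})"
    by (intro connected_open_delete) (auto simp: C_def)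
  then have "connected (?g ` (C - {0}))"
    by (intro connected_continuous_image continuous_intros) auto
  moreover have "d \<in> ?g ` (C - {0})"
    using fdK dw by (intro image_eqI[of _ _ "?f d"]) (auto simp: C_def)
  moreover have "?g ` (C - {0}) \<subseteq> - K"
  proof clarify
    fix u assume "u \<in> C" "?g u \<in> K"
    then have "?f (?g u) \<in> ?f ` K" by blast
    then show False
      using \<open>u \<in> C\<close> connected_component_subset unfolding C_def by fastforce
  qed
  ultimately have out: "?g ` (C - {0}) \<subseteq> outside K"
    using outside_same_component[OF _ \<open>d \<in> outside K\<close>] unfolding connected_component_def by blast
  have "open (inside K)"
    using \<open>compact K\<close> by (simp add: compact_imp_closed open_inside)
  then obtain e where e: "e > 0" "ball w e \<subseteq> inside K"
    using assms openE by blast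
  have "norm u \<le> inverse e" if "u \<in> C" for u
  proof (cases "u = 0")
    case False
    then have "?g u \<notin> inside K"
      using out that inside_Int_outside by blast
    then have "e \<le> norm (inverse u)"
      using e by (force simp: dist_norm norm_minus_commute)
    then have "e \<le> inverse (norm u)"
      by (simp add: norm_inverse)
    then show ?thesis
      using e False le_imp_inverse_le by fastforce
  qed (use e in auto)
  then have "bounded C"
    by (auto simp: bounded_iff)
  then show ?thesis
    using fdK by (auto simp: inside_def C_def)
qed

text \<open>An arbitrary connected set \<open>F\<close> stands in for a face, so the faces of the
  theta curve need not be classified.\<close>

lemma theta_no_common_face:
  fixes c1 c2 c3 :: "real \<Rightarrow> complex"
  assumes arcs: "arc c1" "arc c2" "arc c3"
    and start: "pathstart c1 = P" "pathstart c2 = P" "pathstart c3 = P"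
    and finish: "pathfinish c1 = Q" "pathfinish c2 = Q" "pathfinish c3 = Q"
    and c12: "path_image c1 \<inter> path_image c2 = {P, Q}"
    and c13: "path_image c1 \<inter> path_image c3 = {P, Q}"
    and c23: "path_image c2 \<inter> path_image c3 = {P, Q}"
    and F: "connected F" "F \<inter> (path_image c1 \<union> path_image c2 \<union> path_image c3) = {}"
    and a1: "a1 \<in> closure F" "a1 \<in> path_image c1 - {P, Q}"
    and a2: "a2 \<in> closure F" "a2 \<in> path_image c2 - {P, Q}"
    and a3: "a3 \<in> closure F" "a3 \<in> path_image c3 - {P, Q}"
  shows False
proof (cases "F \<inter> inside (path_image c1 \<union> path_image c2) = {}")
  case False
  then show False
    using theta_inside_face[OF assms] by blast
next
  case True
  let ?K = "path_image c1 \<union> path_image c2"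
  let ?f = "\<lambda>w z. inverse (z - w)"
  have F0: "F \<noteq> {}" using a1 by auto
  \<comment> \<open>This keeps any center of inversion chosen inside \<open>?K\<close> off the third
    arc as well.\<close>
  have c3_out: "path_image c3 \<inter> inside ?K = {}"
  proof -
    have "\<not> F \<union> (path_image c3 - {P, Q}) \<subseteq> inside ?K"
      using True F0 by blast
    then have "(F \<union> (path_image c3 - {P, Q})) \<inter> inside ?K = {}"
      using connected_touching_arc_inside[of F ?K c3 a3] F F0 arcs start finish a3 c13 c23 by auto
    then show ?thesis
      using inside_no_overlap c12 by blast
  qed
  have "simple_path (c1 +++ reversepath c2)"
    using arcs start finish c12 by (intro simple_path_join_loop) (auto simp: arc_reversepath)
  moreover have pim: "path_image (c1 +++ reversepath c2) = ?K"
    using start finish by (simp add: path_image_join)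
  ultimately have "inside ?K \<noteq> {}" and op: "open (inside ?K)"
    using Jordan_inside_outside[of "c1 +++ reversepath c2"] start finish by auto
  then obtain w where w: "w \<in> inside ?K" by blast
  \<comment> \<open>\<open>F\<close> is outside \<open>c1 \<union> c2\<close>; inverting at a point inside brings it inside.\<close>
  then have wn: "w \<notin> path_image c1" "w \<notin> path_image c2" "w \<notin> path_image c3" "w \<notin> closure F"
    using inside_no_overlap c3_out True op open_Int_closure_eq_empty[of "inside ?K" F] by blast+
  define f where "f = ?f w"
  have inj: "inj f" by (auto simp: f_def inj_def)
  have cont: "continuous_on (- {w}) f"
    unfolding f_def by (intro continuous_intros) auto
  have arcf: "arc (f \<circ> c)" if "arc c" "w \<notin> path_image c" for c
    using that inj cont
    by (auto simp: arc_def intro!: path_continuous_image comp_inj_on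
        intro: continuous_on_subset inj_on_subset)
  have img: "f ` A \<inter> f ` B = {f P, f Q}" if "A \<inter> B = {P, Q}" for A B
    using that inj by (metis image_Int image_empty image_insert)
  have cl: "f a \<in> closure (f ` F)" if "a \<in> closure F" for a
    using that wn continuous_on_subset[OF cont, of "closure F"]
      continuous_image_closure_subset by blast
  have conF: "connected (f ` F)"
    using F(1) wn closure_subset by (intro connected_continuous_image continuous_on_subset[OF cont]) auto
  have disj: "f ` F \<inter> (f ` path_image c1 \<union> f ` path_image c2 \<union> f ` path_image c3) = {}"
    using F(2) inj by (auto simp: inj_def)
  obtain d where d: "d \<in> F" using F0 by blast
  have "d \<in> outside ?K"
    using True d F(2) by (auto simp: outside_inside)
  then have "f d \<in> inside (f ` ?K)"
    unfolding f_def using arcs w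
    by (intro inversion_outside_to_inside) (auto simp: compact_Un compact_arc_image arc_imp_path)
  then have "f ` F \<inter> inside (path_image (f \<circ> c1) \<union> path_image (f \<circ> c2)) \<noteq> {}"
    using d by (auto simp: path_image_compose image_Un)
  moreover have "f a \<in> f ` A - {f P, f Q}" if "a \<in> A - {P, Q}" for a A
    using that inj by (auto simp: inj_def)
  ultimately show False
    using theta_inside_face[of "f \<circ> c1" "f \<circ> c2" "f \<circ> c3" "f P" "f Q" "f ` F" "f a1" "f a2" "f a3"]
      arcs wn start finish arcf img[OF c12] img[OF c13] img[OF c23] conF disj cl a1 a2 a3
    by (simp add: path_image_compose pathstart_compose pathfinish_compose)
qed

subsection \<open>Planar drawings\<close>

lemma arc_minus_finish:
  assumes "arc g"
  shows "connected (path_image g - {pathfinish g})" and "pathfinish g \<in> closure (path_image g - {pathfinish g})"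
proof -
  have cont: "continuous_on {0..1} g" and inj: "inj_on g {0..1}"
    using assms by (auto simp: arc_def path_def)
  have eq: "path_image g - {pathfinish g} = g ` {0..<1}"
  proof -
    have "g ` {0..1} - g ` {1} = g ` ({0..1} - {1})"
      using inj_on_image_set_diff[OF inj, of "{0..1}" "{1}"] by simp
    moreover have "{0..1} - {1::real} = {0..<1}"
      by auto
    ultimately show ?thesis
      by (simp add: path_image_def pathfinish_def)
  qed
  show "connected (path_image g - {pathfinish g})"
    unfolding eq by (intro connected_continuous_image continuous_on_subset[OF cont]) auto
  have "g ` closure {0..<1} \<subseteq> closure (g ` {0..<1})"
    using cont by (intro continuous_image_closure_subset[of "closure {0..<1}"]) auto
  then show "pathfinish g \<in> closure (path_image g - {pathfinish g})"
    unfolding eq by (auto simp: pathfinish_def)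
qed

lemma no_K33_drawing:
  fixes a b :: "nat \<Rightarrow> complex" and g :: "nat \<Rightarrow> nat \<Rightarrow> real \<Rightarrow> complex"
  assumes g: "\<And>i j. i < 3 \<Longrightarrow> j < 3 \<Longrightarrow> arc (g i j) \<and> pathstart (g i j) = a i \<and> pathfinish (g i j) = b j"
    and disj: "\<And>i j i' j'. i < 3 \<Longrightarrow> j < 3 \<Longrightarrow> i' < 3 \<Longrightarrow> j' < 3 \<Longrightarrow> i \<noteq> i' \<Longrightarrow> j \<noteq> j' \<Longrightarrow>
      path_image (g i j) \<inter> path_image (g i' j') = {}"
    and same_finish: "\<And>i i' j. i < 3 \<Longrightarrow> i' < 3 \<Longrightarrow> j < 3 \<Longrightarrow> i \<noteq> i' \<Longrightarrow>
      path_image (g i j) \<inter> path_image (g i' j) \<subseteq> {b j}"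
    and same_start: "\<And>i j j'. i < 3 \<Longrightarrow> j < 3 \<Longrightarrow> j' < 3 \<Longrightarrow> j \<noteq> j' \<Longrightarrow>
      path_image (g i j) \<inter> path_image (g i j') \<subseteq> {a i}"
  shows False
proof -
  define A where "A i j = path_image (g i j)" for i j
  have mem: "a i \<in> A i j" "b j \<in> A i j" if "i < 3" "j < 3" for i j
    using g[OF that] pathstart_in_path_image[of "g i j"] pathfinish_in_path_image[of "g i j"]
    by (auto simp: A_def)
  have disjA: "A i j \<inter> A i' j' = {}" if "i < 3" "j < 3" "i' < 3" "j' < 3" "i \<noteq> i'" "j \<noteq> j'" for i j i' j'
    using disj that by (simp add: A_def)
  have finA: "A i j \<inter> A i' j \<subseteq> {b j}" if "i < 3" "j < 3" "i' < 3" "i \<noteq> i'" for i j i'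
    using same_finish that by (simp add: A_def)
  have staA: "A i j \<inter> A i j' \<subseteq> {a i}" if "i < 3" "j < 3" "j' < 3" "j \<noteq> j'" for i j j'
    using same_start that by (simp add: A_def)
  \<comment> \<open>The strands of the theta curve: strand \<open>k\<close> runs from
    \<open>a 0\<close> through \<open>b k\<close> to \<open>a 1\<close>.\<close>
  define c where "c k = g 0 k +++ reversepath (g 1 k)" for k
  have c: "arc (c k)" "pathstart (c k) = a 0" "pathfinish (c k) = a 1" "path_image (c k) = A 0 k \<union> A 1 k"
    if "k < 3" for k
    using g[of 0 k] g[of 1 k] same_finish[of 0 1 k] that
    by (auto simp: c_def A_def path_image_join arc_reversepath intro!: arc_join)
  have cc: "path_image (c k) \<inter> path_image (c l) = {a 0, a 1}" if "k < 3" "l < 3" "k \<noteq> l" for k l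
  proof
    show "path_image (c k) \<inter> path_image (c l) \<subseteq> {a 0, a 1}"
      using disjA[of 0 k 1 l] disjA[of 1 k 0 l] staA[of 0 k l] staA[of 1 k l] that c by auto
    show "{a 0, a 1} \<subseteq> path_image (c k) \<inter> path_image (c l)"
      using mem[of 0] mem[of 1] that c by auto
  qed
  \<comment> \<open>The remaining vertex \<open>a 2\<close> with its three edges, their ends
    \<open>b k\<close> removed: a connected star off the theta curve with every \<open>b k\<close>
    in its closure.\<close>
  define F where "F = (\<Union>k<3. A 2 k - {b k})"
  have half: "connected (A 2 k - {b k})" "b k \<in> closure (A 2 k - {b k})" if "k < 3" for k
    using arc_minus_finish[of "g 2 k"] g[of 2 k] that by (auto simp: A_def)
  have "a 2 \<in> A 2 k - {b k}" if "k < 3" for k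
    using mem[of 2 k] g[of 2 k] arc_distinct_ends[of "g 2 k"] that by auto
  then have "(\<Inter>k<3. A 2 k - {b k}) \<noteq> {}"
    by blast
  then have conF: "connected F"
    unfolding F_def using half by (intro connected_Union) auto
  have clF: "b k \<in> closure F" if "k < 3" for k
    using half(2)[OF that] closure_mono[of "A 2 k - {b k}" F] that by (auto simp: F_def)
  have "(A 2 l - {b l}) \<inter> path_image (c k) = {}" if "k < 3" "l < 3" for k l
  proof (cases "k = l")
    case True
    then show ?thesis
      using that finA[of 2 k 0] finA[of 2 k 1] by (simp add: c) blast
  next
    case False
    then show ?thesis
      using that disjA[of 2 l 0 k] disjA[of 2 l 1 k] by (simp add: c) blast
  qed
  then have "F \<inter> path_image (c k) = {}" if "k < 3" for k
    using that by (auto simp: F_def)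
  then have disF: "F \<inter> (path_image (c 0) \<union> path_image (c 1) \<union> path_image (c 2)) = {}"
    by (simp add: Int_Un_distrib)
  \<comment> \<open>\<open>b k\<close> is not an end of its strand: for another index
    \<open>l\<close>, the point \<open>a 0\<close> lies on \<open>A 0 l\<close>, which is disjoint
    from \<open>A 1 k\<close>; likewise for \<open>a 1\<close>.\<close>
  have b: "b k \<in> path_image (c k) - {a 0, a 1}" if "k < 3" for k
  proof -
    obtain l :: nat where l: "l < 3" "l \<noteq> k"
      by (metis one_less_numeral_iff semiring_norm(77) zero_less_numeral zero_neq_one)
    have "a 0 \<in> A 0 l" "a 1 \<in> A 1 l" "b k \<in> A 0 k" "b k \<in> A 1 k"
      using mem that l by auto
    then show ?thesis
      using disjA[of 0 l 1 k] disjA[of 1 l 0 k] that l c[of k]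
      by (metis DiffI Un_iff disjoint_iff insert_iff empty_iff
          zero_less_numeral one_less_numeral_iff semiring_norm(77) zero_neq_one)
  qed
  show False
    by (rule theta_no_common_face[of "c 0" "c 1" "c 2" "a 0" "a 1" F "b 0" "b 1" "b 2"])
      (rule c(1-3) cc conF disF clF b; simp)+
qed

text \<open>A drawing fixes only the unordered pair of ends of an edge, whereas joining arcs needs a
  direction.\<close>

lemma arc_orient:
  assumes "arc g" "{pathstart g, pathfinish g} = p ` {u, w}"
  shows "\<exists>h. arc h \<and> pathstart h = p u \<and> pathfinish h = p w \<and> path_image h = path_image g"
proof -
  consider "pathstart g = p u" "pathfinish g = p w" | "pathstart g = p w" "pathfinish g = p u"
    using assms(2) by (auto simp: doubleton_eq_iff)
  then show ?thesis
  proof cases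
    case 2
    then show ?thesis
      using assms by (intro exI[of _ "reversepath g"]) (auto simp: arc_reversepath)
  qed (use assms in blast)
qed

definition K33_edges :: "nat set set" where
  "K33_edges = {{i, j} |i j. i < 3 \<and> 3 \<le> j \<and> j < 6}"

lemma K33_edgeI: "i < 3 \<Longrightarrow> 3 \<le> j \<Longrightarrow> j < 6 \<Longrightarrow> {i, j} \<in> K33_edges"
  unfolding K33_edges_def by blast

lemma K33_not_planar: "\<not> planar {..<6} K33_edges"
proof
  assume "planar {..<6} K33_edges"
  then obtain p :: "nat \<Rightarrow> real^2" and \<gamma> where
    arc: "\<And>e. e \<in> K33_edges \<Longrightarrow> arc (\<gamma> e) \<and> {pathstart (\<gamma> e), pathfinish (\<gamma> e)} = p ` e"
    and cross: "\<And>e f. e \<in> K33_edges \<Longrightarrow> f \<in> K33_edges \<Longrightarrow> e \<noteq> f \<Longrightarrow>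
      path_image (\<gamma> e) \<inter> path_image (\<gamma> f) \<subseteq> p ` (e \<inter> f)"
    unfolding planar_def by metis
  \<comment> \<open>The theta-curve lemmas live in \<open>complex\<close>; this continuous injection
    carries the drawing there.\<close>
  define \<phi> :: "real^2 \<Rightarrow> complex" where "\<phi> x = Complex (x $ 1) (x $ 2)" for x
  have inj: "inj \<phi>"
    by (auto simp: inj_def \<phi>_def vec_eq_iff forall_2)
  have "continuous_on UNIV \<phi>"
    unfolding \<phi>_def Complex_eq by (intro continuous_intros)
  then have arc\<phi>: "arc (\<phi> \<circ> h)" if "arc h" for h
    using that inj
    by (auto simp: arc_def intro!: path_continuous_image comp_inj_on
        intro: continuous_on_subset inj_on_subset)
  have "\<exists>h. arc h \<and> pathstart h = p i \<and> pathfinish h = p (3 + j) \<and> path_image h = path_image (\<gamma> {i, 3 + j})"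
    if "i < 3" "j < 3" for i j
    using that arc[OF K33_edgeI[of i "3 + j"]] by (intro arc_orient) simp_all
  then obtain h where h: "\<And>i j. i < 3 \<Longrightarrow> j < 3 \<Longrightarrow> arc (h i j) \<and> pathstart (h i j) = p i \<and>
      pathfinish (h i j) = p (3 + j) \<and> path_image (h i j) = path_image (\<gamma> {i, 3 + j})"
    by metis
  have hcross: "path_image (h i j) \<inter> path_image (h i' j') \<subseteq> p ` ({i, 3 + j} \<inter> {i', 3 + j'})"
    if "i < 3" "j < 3" "i' < 3" "j' < 3" "i \<noteq> i' \<or> j \<noteq> j'" for i j i' j'
  proof -
    have "{i, 3 + j} \<in> K33_edges" "{i', 3 + j'} \<in> K33_edges" "{i, 3 + j} \<noteq> {i', 3 + j'}"
      using that by (auto intro!: K33_edgeI simp: doubleton_eq_iff)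
    then show ?thesis using cross h that by metis
  qed
  have \<phi>cross: "path_image (\<phi> \<circ> h i j) \<inter> path_image (\<phi> \<circ> h i' j') \<subseteq> (\<phi> \<circ> p) ` ({i, 3 + j} \<inter> {i', 3 + j'})"
    if "i < 3" "j < 3" "i' < 3" "j' < 3" "i \<noteq> i' \<or> j \<noteq> j'" for i j i' j'
    using image_mono[OF hcross[OF that], of \<phi>] inj
    by (simp add: path_image_compose image_Int image_comp)
  show False
  proof (rule no_K33_drawing[of "\<lambda>i j. \<phi> \<circ> h i j" "\<lambda>i. \<phi> (p i)" "\<lambda>j. \<phi> (p (3 + j))"], goal_cases)
    case (1 i j)
    then show ?case using h arc\<phi> by (simp add: pathstart_compose pathfinish_compose)
  next
    case (2 i j i' j')
    then show ?case using \<phi>cross[of i j i' j'] by auto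
  next
    case (3 i i' j)
    then show ?case using \<phi>cross[of i j i' j] by auto
  next
    case (4 i j j')
    then show ?case using \<phi>cross[of i j i j'] by auto
  qed
qed

lemma planar_subgraph:
  assumes "planar V' E'" "V \<subseteq> V'" "E \<subseteq> E'"
  shows "planar V E"
proof -
  obtain p :: "_ \<Rightarrow> real^2" and \<gamma> where "inj_on p V'"
    "\<forall>e\<in>E'. arc (\<gamma> e) \<and> {pathstart (\<gamma> e), pathfinish (\<gamma> e)} = p ` e"
    "\<forall>e\<in>E'. \<forall>f\<in>E'. e \<noteq> f \<longrightarrow> path_image (\<gamma> e) \<inter> path_image (\<gamma> f) \<subseteq> p ` (e \<inter> f)"
    "\<forall>e\<in>E'. \<forall>v\<in>V'. p v \<in> path_image (\<gamma> e) \<longrightarrow> v \<in> e"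
    using assms(1) unfolding planar_def by (elim exE conjE) (rule that)
  moreover have "inj_on p V"
    using assms(2) calculation(1) inj_on_subset by blast
  ultimately show ?thesis
    unfolding planar_def using assms(2,3)
    by (intro exI[of _ p] exI[of _ \<gamma>] conjI; simp add: subset_eq)
qed

text \<open>The arcs of the two halves are joined at \<open>s\<close>. Edges of \<open>E\<close>
  avoid \<open>s\<close>, so they meet the joined arc at most in \<open>v\<close> or
  \<open>y\<close>. If \<open>{v, y}\<close> already belongs to \<open>E\<close>, its old arc is
  discarded in favor of the new one.\<close>

lemma planar_suppress_vertex:
  assumes planar: "planar (insert s V) (E \<union> {{v, s}, {s, y}})"
    and E: "\<forall>e\<in>E. e \<subseteq> V" and v: "v \<in> V" "y \<in> V" "v \<noteq> y" "s \<notin> V"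
  shows "planar V (insert {v, y} E)"
proof -
  let ?E = "E \<union> {{v, s}, {s, y}}"
  obtain p :: "_ \<Rightarrow> real^2" and \<gamma> where inj: "inj_on p (insert s V)"
    and arc: "\<And>e. e \<in> ?E \<Longrightarrow> arc (\<gamma> e) \<and> {pathstart (\<gamma> e), pathfinish (\<gamma> e)} = p ` e"
    and cross: "\<And>e f. e \<in> ?E \<Longrightarrow> f \<in> ?E \<Longrightarrow> e \<noteq> f \<Longrightarrow>
      path_image (\<gamma> e) \<inter> path_image (\<gamma> f) \<subseteq> p ` (e \<inter> f)"
    and vert: "\<And>e u. e \<in> ?E \<Longrightarrow> u \<in> insert s V \<Longrightarrow> p u \<in> path_image (\<gamma> e) \<Longrightarrow> u \<in> e"
    using planar unfolding planar_def by metis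
  obtain g1 where g1: "arc g1" "pathstart g1 = p v" "pathfinish g1 = p s" "path_image g1 = path_image (\<gamma> {v, s})"
    using arc_orient[of "\<gamma> {v, s}" p v s] arc by blast
  obtain g2 where g2: "arc g2" "pathstart g2 = p s" "pathfinish g2 = p y" "path_image g2 = path_image (\<gamma> {s, y})"
    using arc_orient[of "\<gamma> {s, y}" p s y] arc by blast
  have ne: "{v, s} \<noteq> {s, y}" "v \<noteq> s" "y \<noteq> s" and int: "{v, s} \<inter> {s, y} = {s}"
    using v by (auto simp: doubleton_eq_iff)
  define \<gamma>' where "\<gamma>' = \<gamma>({v, y} := g1 +++ g2)"
  have pim: "path_image (\<gamma>' {v, y}) = path_image (\<gamma> {v, s}) \<union> path_image (\<gamma> {s, y})"
    using g1 g2 by (simp add: \<gamma>'_def path_image_join)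
  have "path_image g1 \<inter> path_image g2 \<subseteq> {pathstart g2}"
    using cross[of "{v, s}" "{s, y}"] ne int g1 g2 by simp
  then have arc': "arc (\<gamma>' {v, y})" "{pathstart (\<gamma>' {v, y}), pathfinish (\<gamma>' {v, y})} = p ` {v, y}"
    using g1 g2 by (auto simp: \<gamma>'_def intro!: arc_join)
  have new_cross: "path_image (\<gamma>' {v, y}) \<inter> path_image (\<gamma>' f) \<subseteq> p ` ({v, y} \<inter> f)"
    if "f \<in> E" "f \<noteq> {v, y}" for f
  proof -
    have "s \<notin> f" using that E v by blast
    then have "f \<noteq> {v, s}" "f \<noteq> {s, y}" by auto
    then have "path_image (\<gamma> {v, s}) \<inter> path_image (\<gamma> f) \<subseteq> p ` ({v, s} \<inter> f)"
      "path_image (\<gamma> {s, y}) \<inter> path_image (\<gamma> f) \<subseteq> p ` ({s, y} \<inter> f)"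
      using that by (intro cross; auto)+
    moreover have "\<gamma>' f = \<gamma> f" using that by (simp add: \<gamma>'_def)
    ultimately have "path_image (\<gamma>' {v, y}) \<inter> path_image (\<gamma>' f) \<subseteq> p ` ({v, s} \<inter> f) \<union> p ` ({s, y} \<inter> f)"
      unfolding pim by (simp only:) blast
    also have "\<dots> \<subseteq> p ` ({v, y} \<inter> f)"
      using \<open>s \<notin> f\<close> by blast
    finally show ?thesis .
  qed
  show ?thesis
    unfolding planar_def
  proof (intro exI[of _ p] exI[of _ \<gamma>'] conjI ballI impI)
    show "inj_on p V" using inj by (auto intro: inj_on_subset)
  next
    fix e assume "e \<in> insert {v, y} E"
    then show "arc (\<gamma>' e)" "{pathstart (\<gamma>' e), pathfinish (\<gamma>' e)} = p ` e"
      using arc' arc[of e] by (cases "e = {v, y}"; simp add: \<gamma>'_def)+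
  next
    fix e f assume ef: "e \<in> insert {v, y} E" "f \<in> insert {v, y} E" "e \<noteq> f"
    then consider "e = {v, y}" "f \<in> E" "f \<noteq> {v, y}" | "f = {v, y}" "e \<in> E" "e \<noteq> {v, y}"
      | "e \<in> E" "f \<in> E" "e \<noteq> {v, y}" "f \<noteq> {v, y}"
      by blast
    then show "path_image (\<gamma>' e) \<inter> path_image (\<gamma>' f) \<subseteq> p ` (e \<inter> f)"
    proof cases
      case 1
      then show ?thesis using new_cross by blast
    next
      case 2
      then show ?thesis using new_cross[of e] by blast
    next
      case 3
      then show ?thesis using cross[of e f] ef by (simp add: \<gamma>'_def)
    qed
  next
    fix e u assume eu: "e \<in> insert {v, y} E" "u \<in> V" "p u \<in> path_image (\<gamma>' e)"
    show "u \<in> e"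
    proof (cases "e = {v, y}")
      case True
      then have "u \<in> {v, s} \<or> u \<in> {s, y}"
        using eu pim vert[of "{v, s}" u] vert[of "{s, y}" u] by auto
      then show ?thesis using True eu v by auto
    next
      case False
      then show ?thesis using eu vert[of e u] by (simp add: \<gamma>'_def)
    qed
  qed
qed

subsection \<open>Kempe switches and renaming of colors\<close>

definition ab_reachable :: "'v set set \<Rightarrow> ('v set \<Rightarrow> nat) \<Rightarrow> nat \<Rightarrow> nat \<Rightarrow> bool" where
  "ab_reachable E c a b \<longleftrightarrow> (\<forall>e\<in>ab_edges E c a b. \<forall>f\<in>ab_edges E c a b. (ab_adj E c a b)\<^sup>*\<^sup>* e f)"

text \<open>Tightness makes every Kempe switch a global exchange of two colors.\<close>

definition kempe_tight :: "'v set set \<Rightarrow> bool" where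
  "kempe_tight E \<longleftrightarrow>
     (\<forall>c\<in>proper_3_edge_colorings E. \<forall>a\<in>{1,2,3}. \<forall>b\<in>{1,2,3}. a \<noteq> b \<longrightarrow> ab_reachable E c a b)"

lemma third_color:
  "a \<in> {1,2,3} \<Longrightarrow> b \<in> {1,2,3} \<Longrightarrow> c \<in> {1,2,3} \<Longrightarrow> d \<in> {1,2,3::nat} \<Longrightarrow>
    a \<noteq> b \<Longrightarrow> a \<noteq> c \<Longrightarrow> b \<noteq> c \<Longrightarrow> d \<noteq> a \<Longrightarrow> d \<noteq> b \<Longrightarrow> d = c"
  by auto

text \<open>The orbit relation of the symmetric group on the colors, the chain-free counterpart of
  \<open>kempe_equiv\<close>.\<close>

definition recoloring :: "'v set set \<Rightarrow> (('v set \<Rightarrow> nat) \<times> ('v set \<Rightarrow> nat)) set" where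
  "recoloring E = {(c, d). c \<in> proper_3_edge_colorings E \<and> d \<in> proper_3_edge_colorings E \<and>
     (\<exists>\<pi>. \<pi> permutes {1,2,3} \<and> d = \<pi> \<circ> c)}"

text \<open>Two representatives instead of the size of a quotient: in this form the property is
  carried over directly by a bijection of colorings.\<close>

definition two_recoloring_classes :: "'v set set \<Rightarrow> bool" where
  "two_recoloring_classes E \<longleftrightarrow>
     (\<exists>c1\<in>proper_3_edge_colorings E. \<exists>c2\<in>proper_3_edge_colorings E. (c1, c2) \<notin> recoloring E \<and>
        (\<forall>c\<in>proper_3_edge_colorings E. (c1, c) \<in> recoloring E \<or> (c2, c) \<in> recoloring E))"

lemma proper_coloringD:
  assumes "c \<in> proper_3_edge_colorings E"
  shows "e \<in> E \<Longrightarrow> c e \<in> {1,2,3}" and "e \<notin> E \<Longrightarrow> c e = 0"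
    and "e \<in> E \<Longrightarrow> f \<in> E \<Longrightarrow> e \<noteq> f \<Longrightarrow> e \<inter> f \<noteq> {} \<Longrightarrow> c e \<noteq> c f"
  using assms unfolding proper_3_edge_colorings_def by simp_all

lemma proper_coloringI:
  assumes "\<And>e. e \<in> E \<Longrightarrow> c e \<in> {1,2,3}" and "\<And>e. e \<notin> E \<Longrightarrow> c e = 0"
    and "\<And>e f. e \<in> E \<Longrightarrow> f \<in> E \<Longrightarrow> e \<noteq> f \<Longrightarrow> e \<inter> f \<noteq> {} \<Longrightarrow> c e \<noteq> c f"
  shows "c \<in> proper_3_edge_colorings E"
  using assms unfolding proper_3_edge_colorings_def by simp

lemma swap_colors_eq_transpose: "swap_colors a b = Transposition.transpose a b"
  by (auto simp: swap_colors_def Transposition.transpose_def fun_eq_iff)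

lemma ab_adj_reach_sym: "(ab_adj E c a b)\<^sup>*\<^sup>* e f \<Longrightarrow> (ab_adj E c a b)\<^sup>*\<^sup>* f e"
  by (rule sympD[OF symp_rtranclp]) (auto intro!: sympI simp: ab_adj_def)

lemma permuted_coloring_proper:
  assumes c: "c \<in> proper_3_edge_colorings E" and \<pi>: "\<pi> permutes {1,2,3}"
  shows "\<pi> \<circ> c \<in> proper_3_edge_colorings E"
proof -
  have mem: "\<pi> k \<in> {1,2,3}" if "k \<in> {1,2,3}" for k
    using permutes_in_image[OF \<pi>] that by blast
  \<comment> \<open>Non-edges carry the value \<open>0\<close>, which a renaming of
    \<open>{1,2,3}\<close> must leave in place.\<close>
  have "\<pi> 0 = 0"
    using \<pi> by (rule permutes_not_in) auto
  moreover have "inj \<pi>"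
    using \<pi> by (rule permutes_inj)
  ultimately show ?thesis
    using c mem by (simp add: proper_3_edge_colorings_def inj_eq)
qed

lemma kempe_tight_switch:
  assumes "kempe_tight E" "c \<in> proper_3_edge_colorings E" "a \<in> {1,2,3}" "b \<in> {1,2,3}" "a \<noteq> b"
    and "e0 \<in> ab_edges E c a b"
  shows "kempe_switch c a b (kempe_chain E c a b e0) = Transposition.transpose a b \<circ> c"
proof -
  have "kempe_chain E c a b e0 = ab_edges E c a b"
    using assms by (auto simp: kempe_chain_def kempe_tight_def ab_reachable_def)
  moreover have "c e = 0" if "e \<notin> E" for e
    using that assms by (auto simp: proper_3_edge_colorings_def)
  ultimately show ?thesis
    using assms(3,4)
    by (force simp: kempe_switch_def ab_edges_def swap_colors_eq_transpose fun_eq_iff Transposition.transpose_def)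
qed

text \<open>The renaming is a transposition, hence its own inverse. Both equations are recorded so
  that forward and converse steps are covered alike.\<close>

lemma kempe_step_tight:
  assumes "kempe_tight E" "(c, d) \<in> kempe_step E"
  shows "\<exists>\<pi>. \<pi> permutes {1,2,3} \<and> d = \<pi> \<circ> c \<and> c = \<pi> \<circ> d"
proof -
  obtain a b where ab: "a \<in> {1,2,3}" "b \<in> {1,2,3}" "d = Transposition.transpose a b \<circ> c"
    using assms kempe_tight_switch[OF assms(1)] by (force simp: kempe_step_def)
  then show ?thesis
    by (intro exI[of _ "Transposition.transpose a b"]) (simp add: permutes_swap_id o_assoc[symmetric] fun_eq_iff)
qed

text \<open>Every switch is a transposition of colors, and transpositions generate the symmetric
  group.\<close>

lemma kempe_equiv_tight:
  assumes tight: "kempe_tight E"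
  shows "kempe_equiv E = recoloring E"
proof (intro equalityI subrelI)
  fix c d assume "(c, d) \<in> kempe_equiv E"
  then have cd: "c \<in> proper_3_edge_colorings E" "d \<in> proper_3_edge_colorings E"
    "(c, d) \<in> (kempe_step E \<union> (kempe_step E)\<inverse>)\<^sup>*"
    by (auto simp: kempe_equiv_def)
  from cd(3) have "\<exists>\<pi>. \<pi> permutes {1,2,3} \<and> d = \<pi> \<circ> c"
  proof induction
    case base
    show ?case by (intro exI[of _ id] conjI permutes_id) simp
  next
    case (step d d')
    then obtain \<pi> where \<pi>: "\<pi> permutes {1,2,3}" "d = \<pi> \<circ> c" by blast
    obtain \<tau> where \<tau>: "\<tau> permutes {1,2,3}" "d' = \<tau> \<circ> d"
      using step(2) kempe_step_tight[OF tight] by blast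
    have "d' = (\<tau> \<circ> \<pi>) \<circ> c" using \<pi> \<tau> by (simp add: o_assoc)
    moreover have "(\<tau> \<circ> \<pi>) permutes {1,2,3}" using \<pi> \<tau> permutes_compose by blast
    ultimately show ?case by blast
  qed
  then show "(c, d) \<in> recoloring E"
    using cd by (simp add: recoloring_def)
next
  fix c d assume "(c, d) \<in> recoloring E"
  then obtain \<pi> where \<pi>: "\<pi> permutes {1,2,3}" and d: "d = \<pi> \<circ> c"
    and cd: "c \<in> proper_3_edge_colorings E" "d \<in> proper_3_edge_colorings E"
    by (auto simp: recoloring_def)
  have "finite {1,2,3::nat}" by simp
  from \<pi> this have "(c, \<pi> \<circ> c) \<in> (kempe_step E \<union> (kempe_step E)\<inverse>)\<^sup>*"
  proof (induction rule: permutes_induct)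
    case id
    show ?case by simp
  next
    case (swap a b \<pi>)
    have P: "\<pi> \<circ> c \<in> proper_3_edge_colorings E"
      using swap cd permuted_coloring_proper by blast
    \<comment> \<open>If neither color occurs, there is no chain to switch, but then the
      transposition leaves the coloring unchanged; hence the reflexive closure.\<close>
    have "(\<pi> \<circ> c, Transposition.transpose a b \<circ> (\<pi> \<circ> c)) \<in> (kempe_step E)\<^sup>="
    proof (cases "ab_edges E (\<pi> \<circ> c) a b = {}")
      case True
      have "Transposition.transpose a b ((\<pi> \<circ> c) e) = (\<pi> \<circ> c) e" for e
      proof (cases "e \<in> E")
        case True
        then show ?thesis using \<open>ab_edges E (\<pi> \<circ> c) a b = {}\<close> by (auto simp: ab_edges_def Transposition.transpose_def)
      next
        case False
        then have "(\<pi> \<circ> c) e = 0" using P by (simp add: proper_3_edge_colorings_def)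
        then show ?thesis using swap by (auto simp: Transposition.transpose_def)
      qed
      then show ?thesis by (simp add: fun_eq_iff)
    next
      case False
      then obtain e0 where e0: "e0 \<in> ab_edges E (\<pi> \<circ> c) a b" by blast
      have "(\<pi> \<circ> c, Transposition.transpose a b \<circ> (\<pi> \<circ> c)) \<in> kempe_step E"
        unfolding kempe_step_def mem_Collect_eq prod.case
        using kempe_tight_switch[OF tight P swap(1-3) e0] swap(1-3) e0 P
        by (intro conjI exI[of _ a] exI[of _ b] exI[of _ e0]) simp_all
      then show ?thesis by blast
    qed
    then have "(\<pi> \<circ> c, Transposition.transpose a b \<circ> (\<pi> \<circ> c)) \<in> (kempe_step E \<union> (kempe_step E)\<inverse>)\<^sup>*"
      by (metis Un_iff pair_in_Id_conv r_into_rtrancl rtrancl.rtrancl_refl)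
    then show ?case
      unfolding comp_assoc by (rule rtrancl_trans[OF swap.IH])
  qed
  then show "(c, d) \<in> kempe_equiv E"
    using cd d by (simp add: kempe_equiv_def)
qed

lemma equiv_recoloring: "equiv (proper_3_edge_colorings E) (recoloring E)"
proof (rule equivI)
  show "recoloring E \<subseteq> proper_3_edge_colorings E \<times> proper_3_edge_colorings E"
    by (auto simp: recoloring_def)
  show "refl_on (proper_3_edge_colorings E) (recoloring E)"
    unfolding refl_on_def recoloring_def by (auto intro!: exI[of _ id] permutes_id)
  show "sym (recoloring E)"
  proof (rule symI)
    fix c d assume "(c, d) \<in> recoloring E"
    then obtain \<pi> where \<pi>: "\<pi> permutes {1,2,3}" "d = \<pi> \<circ> c"
      and cd: "c \<in> proper_3_edge_colorings E" "d \<in> proper_3_edge_colorings E"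
      by (auto simp: recoloring_def)
    then have "c = inv \<pi> \<circ> d"
      by (simp add: o_assoc permutes_inv_o)
    then show "(d, c) \<in> recoloring E"
      using cd \<pi> permutes_inv unfolding recoloring_def by blast
  qed
  show "trans (recoloring E)"
  proof (rule transI)
    fix c d e assume "(c, d) \<in> recoloring E" "(d, e) \<in> recoloring E"
    then obtain \<pi> \<tau> where "\<pi> permutes {1,2,3}" "d = \<pi> \<circ> c" "\<tau> permutes {1,2,3}" "e = \<tau> \<circ> d"
      and "c \<in> proper_3_edge_colorings E" "e \<in> proper_3_edge_colorings E"
      by (auto simp: recoloring_def)
    moreover from this have "e = (\<tau> \<circ> \<pi>) \<circ> c" "(\<tau> \<circ> \<pi>) permutes {1,2,3}"
      using permutes_compose by (auto simp: o_assoc)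
    ultimately show "(c, e) \<in> recoloring E"
      unfolding recoloring_def by blast
  qed
qed

lemma edge_kempe_classes_two:
  assumes "kempe_tight E" "two_recoloring_classes E"
  shows "edge_kempe_classes E = 2"
proof -
  let ?P = "proper_3_edge_colorings E" and ?R = "recoloring E"
  obtain c1 c2 where c: "c1 \<in> ?P" "c2 \<in> ?P" "(c1, c2) \<notin> ?R"
    and all: "\<And>c. c \<in> ?P \<Longrightarrow> (c1, c) \<in> ?R \<or> (c2, c) \<in> ?R"
    using assms(2) unfolding two_recoloring_classes_def by blast
  have "?R `` {c} \<in> {?R `` {c1}, ?R `` {c2}}" if "c \<in> ?P" for c
    using all[OF that] equiv_class_eq[OF equiv_recoloring] by blast
  then have "?P // ?R = {?R `` {c1}, ?R `` {c2}}"
    using c unfolding quotient_def by blast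
  moreover have "?R `` {c1} \<noteq> ?R `` {c2}"
    using c eq_equiv_class[OF _ equiv_recoloring] by blast
  ultimately show ?thesis
    by (simp add: edge_kempe_classes_def kempe_equiv_tight[OF assms(1)])
qed

subsection \<open>Replacing a vertex by a triangle\<close>

text \<open>The vertex \<open>v\<close> is kept as the triangle corner towards \<open>x\<close>, and
  \<open>p\<close>, \<open>q\<close> are the corners towards \<open>y\<close>, \<open>z\<close>.
  Thus \<open>{v, x}\<close> is an edge of both graphs and only two spokes move.\<close>

locale triangle_expansion =
  fixes V :: "'v set" and E0 :: "'v set set" and v x y z p q :: 'v and E E' :: "'v set set"
  assumes simple: "simple_graph V E"
    and E_eq: "E = E0 \<union> {{v, x}, {v, y}, {v, z}}"
    and E'_eq: "E' = E0 \<union> {{v, x}, {p, y}, {q, z}} \<union> {{v, p}, {v, q}, {p, q}}"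
    and v_E0: "\<And>e. e \<in> E0 \<Longrightarrow> v \<notin> e"
    and xyz: "x \<noteq> y" "x \<noteq> z" "y \<noteq> z"
    and pq: "p \<notin> V" "q \<notin> V" "p \<noteq> q"
begin

lemma in_V: "v \<in> V" "x \<in> V" "y \<in> V" "z \<in> V"
  using simple by (auto simp: simple_graph_def E_eq)

lemma v_neq: "v \<noteq> x" "v \<noteq> y" "v \<noteq> z"
  using simple by (auto simp: simple_graph_def E_eq)

lemma neq [simp]:
  "x \<noteq> y" "x \<noteq> z" "y \<noteq> z" "y \<noteq> x" "z \<noteq> x" "z \<noteq> y"
  "v \<noteq> x" "v \<noteq> y" "v \<noteq> z" "x \<noteq> v" "y \<noteq> v" "z \<noteq> v"
  "p \<noteq> x" "p \<noteq> y" "p \<noteq> z" "x \<noteq> p" "y \<noteq> p" "z \<noteq> p"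
  "q \<noteq> x" "q \<noteq> y" "q \<noteq> z" "x \<noteq> q" "y \<noteq> q" "z \<noteq> q"
  "v \<noteq> p" "v \<noteq> q" "p \<noteq> v" "q \<noteq> v" "p \<noteq> q" "q \<noteq> p"
  using xyz pq in_V v_neq by auto

lemma E0_subset: "e \<in> E0 \<Longrightarrow> e \<subseteq> V - {v}"
  using simple v_E0 by (auto simp: simple_graph_def E_eq)

lemma E0_notin: "e \<in> E0 \<Longrightarrow> v \<notin> e" "e \<in> E0 \<Longrightarrow> p \<notin> e" "e \<in> E0 \<Longrightarrow> q \<notin> e"
  using E0_subset pq by auto

lemma new_notin_E0 [simp]:
  "{v, u} \<notin> E0" "{u, v} \<notin> E0" "{p, u} \<notin> E0" "{u, p} \<notin> E0" "{q, u} \<notin> E0" "{u, q} \<notin> E0"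
  using E0_notin by blast+

lemma simple_expansion: "simple_graph (insert p (insert q V)) E'"
  using simple in_V by (auto simp: simple_graph_def E_eq E'_eq)

lemma card_expansion: "card (insert p (insert q V)) = card V + 2"
  using simple pq by (simp add: simple_graph_def)

lemma cubic_expansion:
  assumes "cubic V E"
  shows "cubic (insert p (insert q V)) E'"
proof -
  have "finite E"
    using simple finite_subset[of E "Pow V"] by (auto simp: simple_graph_def)
  then have fin: "finite {e \<in> E0. w \<in> e}" for w
    by (simp add: E_eq)
  have deg: "degree E' w = degree E w" if "w \<in> V - {v}" for w
  proof -
    let ?D = "{e \<in> E0. w \<in> e}"
    have "w \<noteq> v" "w \<noteq> p" "w \<noteq> q" using that pq by auto
    let ?A = "{e \<in> {{v, x}, {v, y}, {v, z}}. w \<in> e}"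
    let ?B = "{e \<in> {{v, x}, {p, y}, {q, z}, {v, p}, {v, q}, {p, q}}. w \<in> e}"
    have "{e \<in> E. w \<in> e} = ?D \<union> ?A" "{e \<in> E'. w \<in> e} = ?D \<union> ?B"
    proof -
      have split: "{e \<in> A \<union> B. w \<in> e} = {e \<in> A. w \<in> e} \<union> {e \<in> B. w \<in> e}" for A B by blast
      have E': "E' = E0 \<union> {{v, x}, {p, y}, {q, z}, {v, p}, {v, q}, {p, q}}"
        by (simp add: E'_eq insert_commute)
      show "{e \<in> E. w \<in> e} = ?D \<union> ?A" unfolding E_eq by (rule split)
      show "{e \<in> E'. w \<in> e} = ?D \<union> ?B" unfolding E' by (rule split)
    qed
    moreover have "card (?D \<union> ?A) = card ?D + card ?A" "card (?D \<union> ?B) = card ?D + card ?B"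
      by (rule card_Un_disjoint; use fin E0_notin in force)+
    moreover have "card ?A = card ?B"
    proof -
      consider "w = x" | "w = y" | "w = z" | "w \<notin> {x, y, z}" by blast
      then show ?thesis
      proof cases
        case 1
        then have "?A = {{v, x}}" "?B = {{v, x}}" by auto
        then show ?thesis by simp
      next
        case 2
        then have "?A = {{v, y}}" "?B = {{p, y}}" by auto
        then show ?thesis by simp
      next
        case 3
        then have "?A = {{v, z}}" "?B = {{q, z}}" by auto
        then show ?thesis by simp
      next
        case 4
        then have "?A = {}" "?B = {}" using \<open>w \<noteq> v\<close> \<open>w \<noteq> p\<close> \<open>w \<noteq> q\<close> by auto
        then show ?thesis by (simp only:)
      qed
    qed
    ultimately show ?thesis
      by (simp add: degree_def)
  qed
  have "{e \<in> E'. v \<in> e} = {{v, x}, {v, p}, {v, q}}"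
    "{e \<in> E'. p \<in> e} = {{p, y}, {v, p}, {p, q}}"
    "{e \<in> E'. q \<in> e} = {{q, z}, {v, q}, {p, q}}"
    using E0_notin by (auto simp: E'_eq)
  then have "degree E' v = 3" "degree E' p = 3" "degree E' q = 3"
    by (auto simp: degree_def doubleton_eq_iff)
  then show ?thesis
    using assms deg by (auto simp: cubic_def)
qed

section \<open>Connectivity after the replacement\<close>

lemma adj_avoiding_reach_sym: "(adj_avoiding F S)\<^sup>*\<^sup>* u w \<Longrightarrow> (adj_avoiding F S)\<^sup>*\<^sup>* w u"
  by (rule sympD[OF symp_rtranclp]) (auto intro!: sympI simp: adj_avoiding_def insert_commute)

text \<open>If \<open>S\<close> misses the triangle, the intact triangle behaves like the old vertex
  \<open>v\<close>, and old paths lift. If \<open>S\<close> meets it, its corners are traded for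
  \<open>v\<close>; the old graph then connects everything except the surviving corners, which are
  attached by hand.\<close>

lemma three_connected_expansion:
  assumes conn: "k_connected 3 V E"
  shows "k_connected 3 (insert p (insert q V)) E'"
  unfolding k_connected_def
proof (intro conjI allI impI)
  show "3 < card (insert p (insert q V))"
    using conn by (simp add: card_expansion k_connected_def del: card_insert_disjoint)
  fix S assume S: "S \<subseteq> insert p (insert q V) \<and> card S < 3"
  let ?R = "adj_avoiding E' S" and ?V' = "insert p (insert q V)"
  have "finite V" using simple by (simp add: simple_graph_def)
  then have finS: "finite S" using S by (meson finite.insertI finite_subset)
  have reach: "connected_minus ?V' E' S" if "r \<in> ?V' - S" "\<And>u. u \<in> ?V' - S \<Longrightarrow> ?R\<^sup>*\<^sup>* u r" for r
    unfolding connected_minus_def using that adj_avoiding_reach_sym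
    by (metis empty_iff rtranclp_trans)
  show "connected_minus ?V' E' S"
  proof (cases "S \<inter> {v, p, q} = {}")
    case True
    then have tri: "?R v p" "?R v q" "?R p v" "?R q v"
      by (auto simp: adj_avoiding_def E'_eq insert_commute)
    have step: "?R\<^sup>*\<^sup>* u w" if "adj_avoiding E S u w" for u w
    proof -
      have uw: "{u, w} \<in> E" "u \<notin> S" "w \<notin> S" using that by (auto simp: adj_avoiding_def)
      have spoke: "?R\<^sup>*\<^sup>* v w'" if "w' \<in> {x, y, z}" "w' \<notin> S" for w'
      proof -
        have "?R v x" if "x \<notin> S" using True that by (auto simp: adj_avoiding_def E'_eq)
        moreover have "?R p y" if "y \<notin> S" using True that by (auto simp: adj_avoiding_def E'_eq)
        moreover have "?R q z" if "z \<notin> S" using True that by (auto simp: adj_avoiding_def E'_eq)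
        ultimately show ?thesis
          using \<open>w' \<in> {x, y, z}\<close> \<open>w' \<notin> S\<close> tri by (auto intro: converse_rtranclp_into_rtranclp)
      qed
      consider "{u, w} \<in> E0" | "u = v" "w \<in> {x, y, z}" | "w = v" "u \<in> {x, y, z}"
        using uw by (auto simp: E_eq doubleton_eq_iff)
      then show ?thesis
      proof cases
        case 1
        then have "?R u w" using uw by (simp add: adj_avoiding_def E'_eq)
        then show ?thesis by blast
      next
        case 2
        then show ?thesis using spoke[of w] uw by simp
      next
        case 3
        then show ?thesis using spoke[of u] uw adj_avoiding_reach_sym by simp
      qed
    qed
    have lift: "?R\<^sup>*\<^sup>* u w" if "(adj_avoiding E S)\<^sup>*\<^sup>* u w" for u w
      using that by induction (auto intro: rtranclp_trans step)
    have "S \<subseteq> V" using True S by auto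
    then have "connected_minus V E S" using conn S by (simp add: k_connected_def)
    then have inV: "?R\<^sup>*\<^sup>* u v" if "u \<in> V - S" for u
      using that True in_V lift unfolding connected_minus_def by blast
    show ?thesis
    proof (rule reach[of v])
      show "v \<in> ?V' - S" using in_V True by auto
      fix u assume "u \<in> ?V' - S"
      then consider "u \<in> V - S" | "u = p" | "u = q" by blast
      then show "?R\<^sup>*\<^sup>* u v" using inV tri by cases auto
    qed
  next
    case False
    then obtain s where s: "s \<in> S" "s \<in> {v, p, q}" by blast
    \<comment> \<open>\<open>S\<close> contains at least one corner, so this set is no larger than
      \<open>S\<close> and 3-connectivity of the old graph applies to it.\<close>
    let ?S0 = "insert v (S - {v, p, q})"
    have "S - {v, p, q} \<subset> S" using s by blast
    then have "card (S - {v, p, q}) < card S" using finS psubset_card_mono by blast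
    then have "card ?S0 < 3" using S finS by (simp add: card_insert_if)
    moreover have "?S0 \<subseteq> V" using S in_V by auto
    ultimately have cm: "connected_minus V E ?S0" using conn by (simp add: k_connected_def)
    have notS: "w \<notin> S" if "w \<in> V - ?S0" for w using that pq by auto
    have step: "?R u w" if "adj_avoiding E ?S0 u w" for u w
    proof -
      have uw: "{u, w} \<in> E" "u \<notin> ?S0" "w \<notin> ?S0" using that unfolding adj_avoiding_def by blast+
      then have E0: "{u, w} \<in> E0" by (auto simp: E_eq doubleton_eq_iff)
      then have "u \<in> V" "w \<in> V" using E0_subset by auto
      then have "u \<notin> S" "w \<notin> S" using uw notS by blast+
      then show ?thesis using E0 by (simp add: adj_avoiding_def E'_eq)
    qed
    have lift: "?R\<^sup>*\<^sup>* u w" if "(adj_avoiding E ?S0)\<^sup>*\<^sup>* u w" for u w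
      using that by induction (auto intro: rtranclp.rtrancl_into_rtrancl step)
    obtain r where r: "r \<in> V - ?S0" using cm by (auto simp: connected_minus_def)
    have inV: "?R\<^sup>*\<^sup>* u r" if "u \<in> V - ?S0" for u
      using that r cm lift unfolding connected_minus_def by blast
    \<comment> \<open>A surviving corner loses its spoke only if the outer end \<open>w\<close> is
      deleted. Together with the deleted corner \<open>s\<close> this exhausts \<open>S\<close>, so
      a second corner survives with its own spoke intact.\<close>
    have S2: "S = {s, w}" if "w \<in> S" "w \<in> {x, y, z}" for w
    proof -
      have "{s, w} \<subseteq> S" "card {s, w} = 2" using s that by auto
      then show ?thesis using S finS card_seteq[of S "{s, w}"] by auto
    qed
    have spoke: "?R\<^sup>*\<^sup>* u r" if "?R u w" "w \<in> {x, y, z}" for u w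
    proof -
      have "w \<in> V - ?S0" using that in_V by (auto simp: adj_avoiding_def)
      then show ?thesis using inV that by (blast intro: converse_rtranclp_into_rtranclp)
    qed
    have vr: "?R\<^sup>*\<^sup>* v r" if "v \<notin> S" "x \<notin> S"
      using that by (intro spoke[of v x]) (auto simp: adj_avoiding_def E'_eq)
    have pr: "?R\<^sup>*\<^sup>* p r" if "p \<notin> S" "y \<notin> S"
      using that by (intro spoke[of p y]) (auto simp: adj_avoiding_def E'_eq)
    have qr: "?R\<^sup>*\<^sup>* q r" if "q \<notin> S" "z \<notin> S"
      using that by (intro spoke[of q z]) (auto simp: adj_avoiding_def E'_eq)
    have tri: "?R u w" if "u \<in> {v, p, q} - S" "w \<in> {v, p, q} - S" "u \<noteq> w" for u w
      using that by (auto simp: adj_avoiding_def E'_eq doubleton_eq_iff)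
    have via: "?R\<^sup>*\<^sup>* u r" if "?R\<^sup>*\<^sup>* w r" "u \<in> {v, p, q} - S" "w \<in> {v, p, q} - S" "u \<noteq> w" for u w
      using tri[OF that(2-4)] that(1) by (rule converse_rtranclp_into_rtranclp)
    show ?thesis
    proof (rule reach[of r])
      show "r \<in> ?V' - S" using r notS[OF r] by simp
      fix u assume u: "u \<in> ?V' - S"
      then consider "u \<in> V - ?S0" | "u = v" | "u = p" | "u = q" by blast
      then show "?R\<^sup>*\<^sup>* u r"
      proof cases
        case 1
        then show ?thesis by (rule inV)
      next
        case 2
        show ?thesis
        proof (cases "x \<in> S")
          case True
          then have "S = {s, x}" using S2 by blast
          then have "p \<notin> S \<or> q \<notin> S" and "y \<notin> S" "z \<notin> S" using s by (metis insertE singletonD neq, auto)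
          then show ?thesis
            using via[OF pr, of v] via[OF qr, of v] u 2 by (elim disjE) simp_all
        qed (use 2 u vr in auto)
      next
        case 3
        show ?thesis
        proof (cases "y \<in> S")
          case True
          then have "S = {s, y}" using S2 by blast
          then have "v \<notin> S \<or> q \<notin> S" and "x \<notin> S" "z \<notin> S" using s by (metis insertE singletonD neq, auto)
          then show ?thesis
            using via[OF vr, of p] via[OF qr, of p] u 3 by (elim disjE) simp_all
        qed (use 3 u pr in auto)
      next
        case 4
        show ?thesis
        proof (cases "z \<in> S")
          case True
          then have "S = {s, z}" using S2 by blast
          then have "v \<notin> S \<or> p \<notin> S" and "x \<notin> S" "y \<notin> S" using s by (metis insertE singletonD neq, auto)
          then show ?thesis
            using via[OF vr, of q] via[OF pr, of q] u 4 by (elim disjE) simp_all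
        qed (use 4 u qr in auto)
      qed
    qed
  qed
qed

section \<open>Colorings before and after the replacement\<close>

definition proper_base :: "('v set \<Rightarrow> nat) \<Rightarrow> bool" where
  "proper_base c \<longleftrightarrow> (\<forall>e\<in>E0. c e \<in> {1,2,3}) \<and>
     (\<forall>e\<in>E0. \<forall>f\<in>E0. e \<noteq> f \<and> e \<inter> f \<noteq> {} \<longrightarrow> c e \<noteq> c f)"

definition avoids_color :: "('v set \<Rightarrow> nat) \<Rightarrow> 'v \<Rightarrow> nat \<Rightarrow> bool" where
  "avoids_color c u k \<longleftrightarrow> (\<forall>e\<in>E0. u \<in> e \<longrightarrow> c e \<noteq> k)"

text \<open>Splits properness into the part on \<open>E0\<close>, shared with the expanded graph,
  and explicit conditions near \<open>v\<close>. Paired with \<open>proper_expansion_iff\<close>, it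
  reduces the transfer of colorings to comparing finitely many inequalities.\<close>

lemma proper_iff:
  "c \<in> proper_3_edge_colorings E \<longleftrightarrow> proper_base c \<and> (\<forall>e. e \<notin> E \<longrightarrow> c e = 0) \<and>
     c {v, x} \<in> {1,2,3} \<and> c {v, y} \<in> {1,2,3} \<and> c {v, z} \<in> {1,2,3} \<and>
     c {v, x} \<noteq> c {v, y} \<and> c {v, x} \<noteq> c {v, z} \<and> c {v, y} \<noteq> c {v, z} \<and>
     avoids_color c x (c {v, x}) \<and> avoids_color c y (c {v, y}) \<and> avoids_color c z (c {v, z})"
  (is "?L \<longleftrightarrow> ?R")
proof
  assume c: ?L
  have ne: "c e \<noteq> c f" if "e \<in> E" "f \<in> E" "e \<noteq> f" "u \<in> e" "u \<in> f" for e f u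
    using proper_coloringD(3)[OF c] that by blast
  have rng: "c e \<in> {1,2,3}" if "e \<in> E" for e
    using proper_coloringD(1)[OF c] that .
  have "proper_base c"
    using ne rng unfolding proper_base_def by (auto simp: E_eq)
  moreover have "avoids_color c w (c {v, w})" if "w \<in> {x, y, z}" for w
    unfolding avoids_color_def
  proof (intro ballI impI)
    fix e assume "e \<in> E0" "w \<in> e"
    moreover from this have "e \<noteq> {v, w}" using E0_notin by blast
    ultimately show "c e \<noteq> c {v, w}"
      using that by (intro ne[of e "{v, w}" w]) (auto simp: E_eq)
  qed
  moreover have "c {v, w} \<noteq> c {v, w'}" if "w \<in> {x, y, z}" "w' \<in> {x, y, z}" "w \<noteq> w'" for w w'
    using that by (intro ne[of _ _ v]) (auto simp: E_eq doubleton_eq_iff)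
  moreover have "\<forall>e. e \<notin> E \<longrightarrow> c e = 0"
    using proper_coloringD(2)[OF c] by blast
  ultimately show ?R
    using rng[of "{v, x}"] rng[of "{v, y}"] rng[of "{v, z}"] by (simp add: E_eq)
next
  assume R: ?R
  have base: "c e \<noteq> c f" if "e \<in> E0" "f \<in> E0" "e \<noteq> f" "e \<inter> f \<noteq> {}" for e f
    using conjunct1[OF R] that by (simp add: proper_base_def)
  have avoids: "avoids_color c w (c {v, w})" if "w \<in> {x, y, z}" for w
    using R that by (elim insertE emptyE) simp_all
  have new: "c e \<noteq> c {v, w}" if "e \<in> E0" "w \<in> {x, y, z}" "e \<inter> {v, w} \<noteq> {}" for e w
  proof -
    have "w \<in> e" using that E0_notin by blast
    then show ?thesis using avoids that unfolding avoids_color_def by simp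
  qed
  have ineq: "c {v, x} \<noteq> c {v, y}" "c {v, x} \<noteq> c {v, z}" "c {v, y} \<noteq> c {v, z}"
    using R by simp_all
  have old: "c {v, w} \<noteq> c {v, w'}" if "w \<in> {x, y, z}" "w' \<in> {x, y, z}" "w \<noteq> w'" for w w'
    using that by (elim insertE emptyE) (simp_all add: ineq ineq[symmetric])
  have split: "g \<in> E0 \<or> (\<exists>w\<in>{x, y, z}. g = {v, w})" if "g \<in> E" for g
    using that unfolding E_eq by (elim UnE) auto
  have "c e \<noteq> c f" if "e \<in> E" "f \<in> E" "e \<noteq> f" "e \<inter> f \<noteq> {}" for e f
    using split[OF that(1)] split[OF that(2)]
  proof (elim disjE bexE)
    fix w assume "f \<in> E0" "w \<in> {x, y, z}" "e = {v, w}"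
    then show ?thesis using new[of f w] that by (metis Int_commute)
  next
    fix w w' assume "w \<in> {x, y, z}" "w' \<in> {x, y, z}" "e = {v, w}" "f = {v, w'}"
    then show ?thesis using old[of w w'] that by metis
  qed (use base new that in blast)+
  moreover have "c e \<in> {1,2,3}" if "e \<in> E" for e
    using split[OF that] R by (elim disjE bexE insertE emptyE) (simp_all add: proper_base_def)
  moreover have "c e = 0" if "e \<notin> E" for e
    using R that by simp
  ultimately show ?L
    by (intro proper_coloringI)
qed

lemma proper_expansion_iff:
  "c \<in> proper_3_edge_colorings E' \<longleftrightarrow> proper_base c \<and> (\<forall>e. e \<notin> E' \<longrightarrow> c e = 0) \<and>
     c {v, x} \<in> {1,2,3} \<and> c {p, y} \<in> {1,2,3} \<and> c {q, z} \<in> {1,2,3} \<and>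
     c {v, p} \<in> {1,2,3} \<and> c {v, q} \<in> {1,2,3} \<and> c {p, q} \<in> {1,2,3} \<and>
     c {v, x} \<noteq> c {v, p} \<and> c {v, x} \<noteq> c {v, q} \<and> c {p, y} \<noteq> c {v, p} \<and> c {p, y} \<noteq> c {p, q} \<and>
     c {q, z} \<noteq> c {v, q} \<and> c {q, z} \<noteq> c {p, q} \<and>
     c {v, p} \<noteq> c {v, q} \<and> c {v, p} \<noteq> c {p, q} \<and> c {v, q} \<noteq> c {p, q} \<and>
     avoids_color c x (c {v, x}) \<and> avoids_color c y (c {p, y}) \<and> avoids_color c z (c {q, z})"
  (is "?L \<longleftrightarrow> ?R")
proof
  assume c: ?L
  have ne: "c e \<noteq> c f" if "e \<in> E'" "f \<in> E'" "e \<noteq> f" "u \<in> e" "u \<in> f" for e f u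
    using proper_coloringD(3)[OF c] that by blast
  have rng: "c e \<in> {1,2,3}" if "e \<in> E'" for e
    using proper_coloringD(1)[OF c] that .
  have avoids: "avoids_color c w (c {t, w})" if "{t, w} \<in> E'" "{t, w} \<notin> E0" for t w
    unfolding avoids_color_def
  proof (intro ballI impI)
    fix e assume "e \<in> E0" "w \<in> e"
    moreover from this have "e \<in> E'" "e \<noteq> {t, w}" using that by (auto simp: E'_eq)
    ultimately show "c e \<noteq> c {t, w}"
      using that by (intro ne[of e "{t, w}" w]) simp_all
  qed
  have "proper_base c"
    using ne rng unfolding proper_base_def by (auto simp: E'_eq)
  moreover have "c {v, x} \<noteq> c {v, p}" "c {v, x} \<noteq> c {v, q}" "c {v, p} \<noteq> c {v, q}"
    by (rule ne[of _ _ v]; simp add: E'_eq doubleton_eq_iff)+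
  moreover have "c {p, y} \<noteq> c {v, p}" "c {p, y} \<noteq> c {p, q}" "c {v, p} \<noteq> c {p, q}"
    by (rule ne[of _ _ p]; simp add: E'_eq doubleton_eq_iff)+
  moreover have "c {q, z} \<noteq> c {v, q}" "c {q, z} \<noteq> c {p, q}" "c {v, q} \<noteq> c {p, q}"
    by (rule ne[of _ _ q]; simp add: E'_eq doubleton_eq_iff)+
  moreover have "\<forall>e. e \<notin> E' \<longrightarrow> c e = 0"
    using proper_coloringD(2)[OF c] by blast
  moreover have "avoids_color c x (c {v, x})" "avoids_color c y (c {p, y})" "avoids_color c z (c {q, z})"
    by (rule avoids; simp add: E'_eq)+
  moreover have "c {v, x} \<in> {1,2,3}" "c {p, y} \<in> {1,2,3}" "c {q, z} \<in> {1,2,3}"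
    "c {v, p} \<in> {1,2,3}" "c {v, q} \<in> {1,2,3}" "c {p, q} \<in> {1,2,3}"
    by (rule rng; simp add: E'_eq)+
  ultimately show ?R
    by - (intro conjI; assumption)
next
  assume R: ?R
  let ?N = "{{v, x}, {p, y}, {q, z}, {v, p}, {v, q}, {p, q}}"
  have base: "c e \<noteq> c f" if "e \<in> E0" "f \<in> E0" "e \<noteq> f" "e \<inter> f \<noteq> {}" for e f
    using conjunct1[OF R] that by (simp add: proper_base_def)
  have new: "c e \<noteq> c f" if "e \<in> E0" "f \<in> ?N" "e \<inter> f \<noteq> {}" for e f
  proof -
    have "v \<notin> e" "p \<notin> e" "q \<notin> e" using that E0_notin by blast+
    then have "(f = {v, x} \<and> x \<in> e) \<or> (f = {p, y} \<and> y \<in> e) \<or> (f = {q, z} \<and> z \<in> e)"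
      using that(2,3) by auto
    moreover have "avoids_color c x (c {v, x})" "avoids_color c y (c {p, y})" "avoids_color c z (c {q, z})"
      using R by simp_all
    ultimately show ?thesis using that(1) unfolding avoids_color_def by auto
  qed
  have ineq: "c {v, x} \<noteq> c {v, p}" "c {v, x} \<noteq> c {v, q}" "c {p, y} \<noteq> c {v, p}" "c {p, y} \<noteq> c {p, q}"
    "c {q, z} \<noteq> c {v, q}" "c {q, z} \<noteq> c {p, q}" "c {v, p} \<noteq> c {v, q}" "c {v, p} \<noteq> c {p, q}" "c {v, q} \<noteq> c {p, q}"
    using R by simp_all
  have old: "c e \<noteq> c f" if "e \<in> ?N" "f \<in> ?N" "e \<noteq> f" "e \<inter> f \<noteq> {}" for e f
    using that by (elim insertE emptyE) (simp_all add: ineq ineq[symmetric])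
  have split: "g \<in> E0 \<or> g \<in> ?N" if "g \<in> E'" for g
    using that unfolding E'_eq by (elim UnE insertE emptyE) simp_all
  have "c e \<noteq> c f" if "e \<in> E'" "f \<in> E'" "e \<noteq> f" "e \<inter> f \<noteq> {}" for e f
    using split[OF that(1)] split[OF that(2)]
  proof (elim disjE)
    assume "e \<in> ?N" "f \<in> E0"
    then show ?thesis using new[of f e] that by (metis Int_commute)
  qed (fact base[OF _ _ that(3,4)] new[OF _ _ that(4)] old[OF _ _ that(3,4)])+
  moreover have "c e \<in> {1,2,3}" if "e \<in> E'" for e
    using split[OF that] R by (elim disjE insertE) (simp_all add: proper_base_def)
  moreover have "c e = 0" if "e \<notin> E'" for e
    using R that by simp
  ultimately show ?L
    by (intro proper_coloringI)
qed

lemma E0_neq: "e \<in> E0 \<Longrightarrow> e \<noteq> {v, u}" "e \<in> E0 \<Longrightarrow> e \<noteq> {p, u}" "e \<in> E0 \<Longrightarrow> e \<noteq> {q, u}"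
  by auto

text \<open>The two spokes that disappear are reset to \<open>0\<close> because colorings vanish off
  the edge set; without this the correspondence would not be a bijection of functions.\<close>

definition expand_coloring :: "('v set \<Rightarrow> nat) \<Rightarrow> 'v set \<Rightarrow> nat" where
  "expand_coloring c = c({v, y} := 0, {v, z} := 0, {p, y} := c {v, y}, {q, z} := c {v, z},
     {v, p} := c {v, z}, {v, q} := c {v, y}, {p, q} := c {v, x})"

definition contract_coloring :: "('v set \<Rightarrow> nat) \<Rightarrow> 'v set \<Rightarrow> nat" where
  "contract_coloring c = c({p, y} := 0, {q, z} := 0, {v, p} := 0, {v, q} := 0, {p, q} := 0,
     {v, y} := c {p, y}, {v, z} := c {q, z})"

lemma expand_coloring_simps [simp]:
  "e \<in> E0 \<Longrightarrow> expand_coloring c e = c e"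
  "expand_coloring c {v, x} = c {v, x}" "expand_coloring c {p, y} = c {v, y}"
  "expand_coloring c {q, z} = c {v, z}" "expand_coloring c {v, p} = c {v, z}"
  "expand_coloring c {v, q} = c {v, y}" "expand_coloring c {p, q} = c {v, x}"
  "expand_coloring c {v, y} = 0" "expand_coloring c {v, z} = 0"
  by (simp_all add: expand_coloring_def doubleton_eq_iff E0_neq)

lemma contract_coloring_simps [simp]:
  "e \<in> E0 \<Longrightarrow> contract_coloring c e = c e"
  "contract_coloring c {v, x} = c {v, x}" "contract_coloring c {v, y} = c {p, y}"
  "contract_coloring c {v, z} = c {q, z}" "contract_coloring c {p, y} = 0" "contract_coloring c {q, z} = 0"
  "contract_coloring c {v, p} = 0" "contract_coloring c {v, q} = 0" "contract_coloring c {p, q} = 0"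
  by (simp_all add: contract_coloring_def doubleton_eq_iff E0_neq)

lemma base_cong:
  assumes "\<And>e. e \<in> E0 \<Longrightarrow> c e = d e"
  shows "proper_base c = proper_base d" "avoids_color c u k = avoids_color d u k"
  using assms by (simp_all add: proper_base_def avoids_color_def)

lemma expand_coloring_proper:
  assumes "c \<in> proper_3_edge_colorings E"
  shows "expand_coloring c \<in> proper_3_edge_colorings E'"
proof -
  have "expand_coloring c e = 0" if "e \<notin> E'" for e
  proof (cases "e = {v, y} \<or> e = {v, z}")
    case False
    then have "e \<notin> E" using that by (auto simp: E_eq E'_eq)
    moreover have "expand_coloring c e = c e"
      using that False by (auto simp: expand_coloring_def E'_eq)
    ultimately show ?thesis using assms proper_iff by simp
  qed auto
  moreover have "\<And>e. e \<in> E0 \<Longrightarrow> expand_coloring c e = c e" by simp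
  note base_cong[OF this]
  ultimately show ?thesis
    using assms unfolding proper_iff proper_expansion_iff by simp
qed

text \<open>The triangle edges are pairwise adjacent and use up all three colors. An outgoing edge
  differs from the two at its corner, so it has the color of the third: nothing is lost by
  forgetting the triangle.\<close>

lemma contract_coloring_proper:
  assumes "c \<in> proper_3_edge_colorings E'"
  shows "contract_coloring c \<in> proper_3_edge_colorings E" "expand_coloring (contract_coloring c) = c"
proof -
  have R: "c {v, x} = c {p, q}" "c {p, y} = c {v, q}" "c {q, z} = c {v, p}"
    using third_color[of "c {v, p}" "c {v, q}" "c {p, q}" "c {v, x}"]
      third_color[of "c {v, p}" "c {p, q}" "c {v, q}" "c {p, y}"]
      third_color[of "c {v, q}" "c {p, q}" "c {v, p}" "c {q, z}"] assms[unfolded proper_expansion_iff]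
    by metis+
  note off = proper_coloringD(2)[OF assms]
  have "contract_coloring c e = 0" if "e \<notin> E" for e
  proof (cases "e \<in> {{p, y}, {q, z}, {v, p}, {v, q}, {p, q}}")
    case False
    then have "e \<notin> E'" using that by (auto simp: E_eq E'_eq)
    moreover have "contract_coloring c e = c e"
      using that False by (auto simp: contract_coloring_def E_eq)
    ultimately show ?thesis using off by simp
  qed auto
  moreover have "\<And>e. e \<in> E0 \<Longrightarrow> contract_coloring c e = c e" by simp
  note base_cong[OF this]
  ultimately show "contract_coloring c \<in> proper_3_edge_colorings E"
    using assms R unfolding proper_iff proper_expansion_iff by simp
  show "expand_coloring (contract_coloring c) = c"
  proof
    fix e
    have "{v, y} \<notin> E'" "{v, z} \<notin> E'" by (auto simp: E'_eq doubleton_eq_iff)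
    then have "c {v, y} = 0" "c {v, z} = 0" using off by blast+
    then show "expand_coloring (contract_coloring c) e = c e"
      using R by (simp add: expand_coloring_def) (simp add: contract_coloring_def)
  qed
qed

lemma contract_expand_coloring:
  assumes "c \<in> proper_3_edge_colorings E"
  shows "contract_coloring (expand_coloring c) = c"
proof
  fix e
  have "{p, y} \<notin> E" "{q, z} \<notin> E" "{v, p} \<notin> E" "{v, q} \<notin> E" "{p, q} \<notin> E"
    by (auto simp: E_eq doubleton_eq_iff)
  then have "c {p, y} = 0" "c {q, z} = 0" "c {v, p} = 0" "c {v, q} = 0" "c {p, q} = 0"
    using proper_coloringD(2)[OF assms] by blast+
  then show "contract_coloring (expand_coloring c) e = c e"
    by (simp add: contract_coloring_def) (simp add: expand_coloring_def)
qed

text \<open>Both maps only copy values or write \<open>0\<close>, and renamings fix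
  \<open>0\<close>; so the maps commute with renaming and match orbits with orbits.\<close>

lemma recoloring_expand_iff:
  assumes c: "c \<in> proper_3_edge_colorings E" and d: "d \<in> proper_3_edge_colorings E"
  shows "(expand_coloring c, expand_coloring d) \<in> recoloring E' \<longleftrightarrow> (c, d) \<in> recoloring E"
proof -
  have comp: "expand_coloring (\<pi> \<circ> f) = \<pi> \<circ> expand_coloring f"
    "contract_coloring (\<pi> \<circ> f) = \<pi> \<circ> contract_coloring f" if "\<pi> permutes {1,2,3}" for \<pi> f
  proof -
    have "\<pi> 0 = 0" using that by (rule permutes_not_in) auto
    then show "expand_coloring (\<pi> \<circ> f) = \<pi> \<circ> expand_coloring f"
      "contract_coloring (\<pi> \<circ> f) = \<pi> \<circ> contract_coloring f"
      by (simp_all add: fun_eq_iff expand_coloring_def contract_coloring_def)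
  qed
  have "expand_coloring d = \<pi> \<circ> expand_coloring c \<longleftrightarrow> d = \<pi> \<circ> c" if "\<pi> permutes {1,2,3}" for \<pi>
    using comp[OF that] contract_expand_coloring c d by metis
  then show ?thesis
    using expand_coloring_proper c d unfolding recoloring_def by blast
qed

lemma two_recoloring_classes_expansion:
  assumes "two_recoloring_classes E"
  shows "two_recoloring_classes E'"
proof -
  obtain c1 c2 where c: "c1 \<in> proper_3_edge_colorings E" "c2 \<in> proper_3_edge_colorings E" "(c1, c2) \<notin> recoloring E"
    and all: "\<And>c. c \<in> proper_3_edge_colorings E \<Longrightarrow> (c1, c) \<in> recoloring E \<or> (c2, c) \<in> recoloring E"
    using assms unfolding two_recoloring_classes_def by blast
  have "(expand_coloring c1, c) \<in> recoloring E' \<or> (expand_coloring c2, c) \<in> recoloring E'"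
    if "c \<in> proper_3_edge_colorings E'" for c
    using all contract_coloring_proper[OF that] recoloring_expand_iff c by metis
  then show ?thesis
    using c recoloring_expand_iff expand_coloring_proper unfolding two_recoloring_classes_def by metis
qed

section \<open>Two-colored chains through the triangle\<close>

definition expand_edge :: "'v set \<Rightarrow> 'v set" where
  "expand_edge e = (if e = {v, y} then {p, y} else if e = {v, z} then {q, z} else e)"

lemma expand_edge_simps [simp]:
  "e \<in> E0 \<Longrightarrow> expand_edge e = e" "expand_edge {v, x} = {v, x}"
  "expand_edge {v, y} = {p, y}" "expand_edge {v, z} = {q, z}"
  by (simp_all add: expand_edge_def doubleton_eq_iff E0_neq)

text \<open>Two facts suffice: images of adjacent chain edges stay joined, possibly through the
  triangle, and every chain edge of the new graph is joined to such an image.\<close>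

lemma kempe_tight_expansion:
  assumes tight: "kempe_tight E"
  shows "kempe_tight E'"
  unfolding kempe_tight_def ab_reachable_def
proof (intro ballI impI)
  fix c' a b e' f'
  assume c': "c' \<in> proper_3_edge_colorings E'" and ab: "a \<in> {1,2,3}" "b \<in> {1,2,3}" "a \<noteq> b"
    and ef: "e' \<in> ab_edges E' c' a b" "f' \<in> ab_edges E' c' a b"
  define c where "c = contract_coloring c'"
  have c: "c \<in> proper_3_edge_colorings E" "c' = expand_coloring c"
    using contract_coloring_proper[OF c'] by (simp_all add: c_def)
  let ?A = "ab_edges E c a b" and ?A' = "ab_edges E' c' a b" and ?R = "ab_adj E' c' a b"
  note reach_sym = ab_adj_reach_sym[of E' c' a b]
  have adj: "?R\<^sup>*\<^sup>* e f" if "e \<in> ?A'" "f \<in> ?A'" "u \<in> e" "u \<in> f" for e f u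
    using that by (intro r_into_rtranclp) (auto simp: ab_adj_def)
  have mem: "expand_edge e \<in> ?A'" if "e \<in> ?A" for e
  proof -
    have "e \<in> E0 \<or> e = {v, x} \<or> e = {v, y} \<or> e = {v, z}"
      using that by (simp add: ab_edges_def E_eq) metis
    then show ?thesis
      using that by (elim disjE) (simp_all add: ab_edges_def c(2) E'_eq)
  qed
  have colors: "c {v, x} \<in> {1,2,3}" "c {v, y} \<in> {1,2,3}" "c {v, z} \<in> {1,2,3}"
    "c {v, x} \<noteq> c {v, y}" "c {v, x} \<noteq> c {v, z}" "c {v, y} \<noteq> c {v, z}"
    using c(1) unfolding proper_iff by simp_all
  have A': "{v, x} \<in> ?A' \<longleftrightarrow> c {v, x} \<in> {a, b}" "{p, y} \<in> ?A' \<longleftrightarrow> c {v, y} \<in> {a, b}"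
    "{q, z} \<in> ?A' \<longleftrightarrow> c {v, z} \<in> {a, b}" "{v, p} \<in> ?A' \<longleftrightarrow> c {v, z} \<in> {a, b}"
    "{v, q} \<in> ?A' \<longleftrightarrow> c {v, y} \<in> {a, b}" "{p, q} \<in> ?A' \<longleftrightarrow> c {v, x} \<in> {a, b}"
    by (simp_all add: ab_edges_def c(2) E'_eq)
  have A: "{v, x} \<in> ?A \<longleftrightarrow> c {v, x} \<in> {a, b}" "{v, y} \<in> ?A \<longleftrightarrow> c {v, y} \<in> {a, b}"
    "{v, z} \<in> ?A \<longleftrightarrow> c {v, z} \<in> {a, b}"
    by (simp_all add: ab_edges_def E_eq)
  \<comment> \<open>The direct triangle edge \<open>{v, p}\<close> has the third color, so the chain
    takes the long way round over \<open>q\<close>, alternating the two colors. The other two pairs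
    of spokes behave in the same way.\<close>
  have xy: "?R\<^sup>*\<^sup>* {v, x} {p, y}" if "{v, x} \<in> ?A" "{v, y} \<in> ?A"
  proof -
    have "?R\<^sup>*\<^sup>* {v, x} {v, q}" using that A A' by (intro adj[of _ _ v]) auto
    also have "?R\<^sup>*\<^sup>* {v, q} {p, q}" using that A A' by (intro adj[of _ _ q]) auto
    also have "?R\<^sup>*\<^sup>* {p, q} {p, y}" using that A A' by (intro adj[of _ _ p]) auto
    finally show ?thesis .
  qed
  have xz: "?R\<^sup>*\<^sup>* {v, x} {q, z}" if "{v, x} \<in> ?A" "{v, z} \<in> ?A"
  proof -
    have "?R\<^sup>*\<^sup>* {v, x} {v, p}" using that A A' by (intro adj[of _ _ v]) auto
    also have "?R\<^sup>*\<^sup>* {v, p} {p, q}" using that A A' by (intro adj[of _ _ p]) auto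
    also have "?R\<^sup>*\<^sup>* {p, q} {q, z}" using that A A' by (intro adj[of _ _ q]) auto
    finally show ?thesis .
  qed
  have yz: "?R\<^sup>*\<^sup>* {p, y} {q, z}" if "{v, y} \<in> ?A" "{v, z} \<in> ?A"
  proof -
    have "?R\<^sup>*\<^sup>* {p, y} {v, p}" using that A A' by (intro adj[of _ _ p]) auto
    also have "?R\<^sup>*\<^sup>* {v, p} {v, q}" using that A A' by (intro adj[of _ _ v]) auto
    also have "?R\<^sup>*\<^sup>* {v, q} {q, z}" using that A A' by (intro adj[of _ _ q]) auto
    finally show ?thesis .
  qed
  have step: "?R\<^sup>*\<^sup>* (expand_edge e) (expand_edge f)" if "ab_adj E c a b e f" for e f
  proof -
    have ef: "e \<in> ?A" "f \<in> ?A" "e \<inter> f \<noteq> {}" using that by (simp_all add: ab_adj_def)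
    show ?thesis
    \<comment> \<open>\<open>expand_edge\<close> only replaces \<open>v\<close> by another corner,
      so any other common vertex survives. What remains is a pair of spokes meeting at
      \<open>v\<close>.\<close>
    proof (cases "\<exists>u. u \<noteq> v \<and> u \<in> e \<and> u \<in> f")
      case True
      then obtain u where u: "u \<noteq> v" "u \<in> e" "u \<in> f" by blast
      then have "u \<in> expand_edge e" "u \<in> expand_edge f" by (auto simp: expand_edge_def)
      then show ?thesis using adj mem ef by blast
    next
      case False
      then have "v \<in> e" "v \<in> f" using ef(3) by auto
      then have spokes: "e \<in> {{v, x}, {v, y}, {v, z}}" "f \<in> {{v, x}, {v, y}, {v, z}}"
        using ef(1,2) E0_notin(1) unfolding ab_edges_def E_eq by blast+
      show ?thesis
        using spokes
        by (elim insertE emptyE; use ef xy xz yz reach_sym[OF xy] reach_sym[OF xz] reach_sym[OF yz] in simp)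
    qed
  qed
  have lift: "?R\<^sup>*\<^sup>* (expand_edge e) (expand_edge f)" if "(ab_adj E c a b)\<^sup>*\<^sup>* e f" for e f
    using that by induction (auto intro: rtranclp_trans step)
  have down: "\<exists>e\<in>?A. ?R\<^sup>*\<^sup>* f (expand_edge e)" if f: "f \<in> ?A'" for f
  proof -
    \<comment> \<open>Two distinct colors out of three cannot both miss \<open>{a, b}\<close>. For a
      triangle edge this is applied to the outgoing edges at its two ends, one of which is thus an
      image in the same chain.\<close>
    have pair: "r \<in> {a, b} \<or> s \<in> {a, b}" if "r \<in> {1,2,3}" "s \<in> {1,2,3}" "r \<noteq> s" for r s
      using third_color[of a b r s] ab that by blast
    have old: ?thesis if "e \<in> ?A" "f = expand_edge e" for e
      using that by blast
    have near: ?thesis if "e \<in> ?A" "u \<in> f" "u \<in> expand_edge e" for e u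
      using adj[OF f mem[OF that(1)] that(2,3)] that(1) by blast
    have "f \<in> E0 \<or> f = {v, x} \<or> f = {p, y} \<or> f = {q, z} \<or> f = {v, p} \<or> f = {v, q} \<or> f = {p, q}"
      using f by (simp add: ab_edges_def E'_eq) metis
    then consider "f \<in> E0" | "f = {v, x}" | "f = {p, y}" | "f = {q, z}"
      | "f = {v, p}" | "f = {v, q}" | "f = {p, q}"
      by argo
    then show ?thesis
    proof cases
      case 1
      then have "f \<in> ?A" using f by (simp add: ab_edges_def E_eq c(2))
      then show ?thesis using 1 by (intro old[of f]) auto
    next
      case 2
      then show ?thesis using f A A' by (intro old[of "{v, x}"]) simp_all
    next
      case 3
      then show ?thesis using f A A' by (intro old[of "{v, y}"]) simp_all
    next
      case 4
      then show ?thesis using f A A' by (intro old[of "{v, z}"]) simp_all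
    next
      case 5
      have "{v, x} \<in> ?A \<or> {v, y} \<in> ?A" unfolding A by (rule pair) (rule colors)+
      then show ?thesis using 5 near[of "{v, x}" v] near[of "{v, y}" p] by (elim disjE) simp_all
    next
      case 6
      have "{v, x} \<in> ?A \<or> {v, z} \<in> ?A" unfolding A by (rule pair) (rule colors)+
      then show ?thesis using 6 near[of "{v, x}" v] near[of "{v, z}" q] by (elim disjE) simp_all
    next
      case 7
      have "{v, y} \<in> ?A \<or> {v, z} \<in> ?A" unfolding A by (rule pair) (rule colors)+
      then show ?thesis using 7 near[of "{v, y}" p] near[of "{v, z}" q] by (elim disjE) simp_all
    qed
  qed
  obtain e f where e: "e \<in> ?A" "?R\<^sup>*\<^sup>* e' (expand_edge e)" and f: "f \<in> ?A" "?R\<^sup>*\<^sup>* f' (expand_edge f)"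
    using down ef by blast
  have "(ab_adj E c a b)\<^sup>*\<^sup>* e f"
    using tight c(1) ab e f unfolding kempe_tight_def ab_reachable_def by blast
  then show "?R\<^sup>*\<^sup>* e' f'"
    using e f lift reach_sym by (metis rtranclp_trans)
qed

section \<open>Contracting the triangle in a drawing\<close>

lemma planar_contract:
  assumes "planar (insert p (insert q V)) E'"
  shows "planar V E"
proof -
  let ?E1 = "E0 \<union> {{v, x}, {v, q}, {q, z}}" and ?E2 = "E0 \<union> {{v, x}, {v, y}}"
  have E0V: "\<forall>e\<in>E0. e \<subseteq> V" using E0_subset by blast
  \<comment> \<open>Here \<open>{p, q}\<close> is dropped, which leaves \<open>p\<close> only
    between \<open>v\<close> and \<open>y\<close>, and \<open>q\<close> only between
    \<open>v\<close> and \<open>z\<close>.\<close>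
  have "planar (insert p (insert q V)) (?E1 \<union> {{v, p}, {p, y}})"
    using assms by (rule planar_subgraph) (auto simp: E'_eq)
  then have "planar (insert q V) (insert {v, y} ?E1)"
    by (rule planar_suppress_vertex) (use E0V in_V pq in auto)
  moreover have "insert {v, y} ?E1 = ?E2 \<union> {{v, q}, {q, z}}" by (simp add: insert_commute)
  ultimately have "planar (insert q V) (?E2 \<union> {{v, q}, {q, z}})" by simp
  then have "planar V (insert {v, z} ?E2)"
    by (rule planar_suppress_vertex) (use E0V in_V pq in auto)
  moreover have "insert {v, z} ?E2 = E" by (simp add: E_eq insert_commute)
  ultimately show ?thesis by simp
qed

end

subsection \<open>The complete bipartite graph\<close>

lemma K33_edges_eq:
  "K33_edges = {{0,3}, {0,4}, {0,5}, {1,3}, {1,4}, {1,5}, {2,3}, {2,4}, {2,5}}"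
proof -
  have "K33_edges = (\<Union>i\<in>{..<3}. \<Union>j\<in>{3..<6}. {{i, j}})"
    unfolding K33_edges_def by fastforce
  moreover have "{..<3} = {0, 1, 2::nat}" "{3..<6} = {3, 4, 5::nat}" by auto
  ultimately show ?thesis by (simp add: insert_commute)
qed

lemma K33_simple: "simple_graph {..<6} K33_edges"
  by (auto simp: simple_graph_def K33_edges_def card_insert_if)

lemma K33_cubic: "cubic {..<6} K33_edges"
  unfolding cubic_def degree_def
proof
  fix v :: nat assume "v \<in> {..<6}"
  then consider "v < 3" | "3 \<le> v" "v < 6" by fastforce
  then show "card {e \<in> K33_edges. v \<in> e} = 3"
  proof cases
    case 1
    then have "{e \<in> K33_edges. v \<in> e} = (\<lambda>j. {v, j}) ` {3..<6}"
      by (auto intro: K33_edgeI) (auto simp: K33_edges_def)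
    moreover have "inj_on (\<lambda>j. {v, j}) {3..<6}"
      by (auto simp: inj_on_def doubleton_eq_iff)
    ultimately show ?thesis by (simp add: card_image)
  next
    case 2
    then have "{e \<in> K33_edges. v \<in> e} = (\<lambda>i. {i, v}) ` {..<3}"
      by (auto intro: K33_edgeI) (auto simp: K33_edges_def)
    moreover have "inj_on (\<lambda>i. {i, v}) {..<3}"
      by (auto simp: inj_on_def doubleton_eq_iff)
    ultimately show ?thesis by (simp add: card_image)
  qed
qed

lemma K33_three_connected: "k_connected 3 {..<6} K33_edges"
  unfolding k_connected_def
proof (intro conjI allI impI)
  fix S :: "nat set" assume S: "S \<subseteq> {..<6} \<and> card S < 3"
  then have "finite S" using finite_subset by blast
  then have "\<not> {..<3} \<subseteq> S" "\<not> {3..<6} \<subseteq> S"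
    using S card_mono[of S "{..<3}"] card_mono[of S "{3..<6}"] by auto
  \<comment> \<open>Each side has three vertices, so one survives on either side; every survivor is
    adjacent to \<open>l\<close> or to \<open>r\<close>, and these two are adjacent.\<close>
  then obtain l r where lr: "l < 3" "l \<notin> S" "3 \<le> r" "r < 6" "r \<notin> S"
    by (auto simp: subset_eq)
  let ?R = "adj_avoiding K33_edges S"
  have adj: "?R i j" "?R j i" if "i < 3" "3 \<le> j" "j < 6" "i \<notin> S" "j \<notin> S" for i j
    using that K33_edgeI[of i j] by (simp_all add: adj_avoiding_def insert_commute)
  have "?R\<^sup>*\<^sup>* u w" if "u < 6" "w < 6" "u \<notin> S" "w \<notin> S" for u w
  proof -
    have "?R\<^sup>*\<^sup>* u l"
    proof (cases "u < 3")
      case True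
      then have "?R u r" "?R r l" using adj lr that by auto
      then show ?thesis by (meson converse_rtranclp_into_rtranclp r_into_rtranclp)
    qed (use adj lr that in auto)
    moreover have "?R\<^sup>*\<^sup>* l w"
    proof (cases "w < 3")
      case True
      then have "?R l r" "?R r w" using adj lr that by auto
      then show ?thesis by (meson converse_rtranclp_into_rtranclp r_into_rtranclp)
    qed (use adj lr that in auto)
    ultimately show ?thesis by (rule rtranclp_trans)
  qed
  moreover have "l \<in> {..<6} - S" using lr by simp
  ultimately show "connected_minus {..<6} K33_edges S"
    unfolding connected_minus_def by blast
qed simp

text \<open>Proper 3-edge-colorings of \<open>K\<^bsub>3,3\<^esub>\<close> are Latin squares of order 3; up to renaming the colors
  there are two of them, \<open>i + s j\<close> modulo 3 for \<open>s = 1, 2\<close>.\<close>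

definition latin :: "nat \<Rightarrow> nat set \<Rightarrow> nat" where
  "latin s e = (if e \<in> K33_edges then (Min e + s * Max e) mod 3 + 1 else 0)"

lemma latin_simps:
  "latin 1 {0,3} = 1" "latin 1 {0,4} = 2" "latin 1 {0,5} = 3"
  "latin 1 {1,3} = 2" "latin 1 {1,4} = 3" "latin 1 {1,5} = 1"
  "latin 1 {2,3} = 3" "latin 1 {2,4} = 1" "latin 1 {2,5} = 2"
  "latin 2 {0,3} = 1" "latin 2 {0,4} = 3" "latin 2 {0,5} = 2"
  "latin 2 {1,3} = 2" "latin 2 {1,4} = 1" "latin 2 {1,5} = 3"
  "latin 2 {2,3} = 3" "latin 2 {2,4} = 2" "latin 2 {2,5} = 1"
  by (simp_all add: latin_def K33_edges_eq)

lemma latin_proper: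
  assumes "s = 1 \<or> s = 2"
  shows "latin s \<in> proper_3_edge_colorings K33_edges"
proof (rule proper_coloringI)
  fix e f assume ef: "e \<in> K33_edges" "f \<in> K33_edges" "e \<noteq> f" "e \<inter> f \<noteq> {}"
  obtain i j where e: "e = {i, j}" "i < 3" "3 \<le> j" "j < 6"
    using ef(1) unfolding K33_edges_def by blast
  obtain i' j' where f: "f = {i', j'}" "i' < 3" "3 \<le> j'" "j' < 6"
    using ef(2) unfolding K33_edges_def by blast
  have val: "latin s {k, l} = (k + s * l) mod 3 + 1" if "k < 3" "3 \<le> l" "l < 6" for k l
    using that K33_edgeI[OF that] by (simp add: latin_def min_def max_def)
  have share: "i = i' \<and> j \<noteq> j' \<or> i \<noteq> i' \<and> j = j'"
    using ef(3,4) e f by auto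
  have "i \<in> {0,1,2}" "i' \<in> {0,1,2}" "j \<in> {3,4,5}" "j' \<in> {3,4,5}"
    using e f by auto
  \<comment> \<open>Edges that share a vertex differ in exactly one index, and the coefficients
    \<open>1\<close> and \<open>s\<close> are both invertible modulo 3.\<close>
  then have "(i + s * j) mod 3 \<noteq> (i' + s * j') mod 3"
    using share assms by (elim insertE emptyE disjE) simp_all
  then show "latin s e \<noteq> latin s f"
    using e f val by simp
qed (auto simp: latin_def)

lemma permutation_of_three:
  fixes a b c :: nat
  assumes "a \<in> {1,2,3}" "b \<in> {1,2,3}" "c \<in> {1,2,3}" "a \<noteq> b" "a \<noteq> c" "b \<noteq> c"
  shows "\<exists>\<pi>. \<pi> permutes {1,2,3} \<and> \<pi> 1 = a \<and> \<pi> 2 = b \<and> \<pi> 3 = c"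
proof -
  let ?\<pi> = "\<lambda>k::nat. if k = 1 then a else if k = 2 then b else if k = 3 then c else k"
  have inj: "inj_on ?\<pi> {1,2,3}"
    using assms by (auto simp: inj_on_def)
  moreover have "?\<pi> ` {1,2,3} \<subseteq> {1,2,3}"
    using assms by auto
  ultimately have "bij_betw ?\<pi> {1,2,3} {1,2,3}"
    unfolding bij_betw_def using endo_inj_surj[of "{1,2,3}" ?\<pi>] by blast
  then have "?\<pi> permutes {1,2,3}"
    by (rule bij_imp_permutes) auto
  then show ?thesis
    by (intro exI[of _ ?\<pi>]) simp
qed

text \<open>Row \<open>0\<close> determines the renaming. The entry \<open>c {1,3}\<close> then has
  two possible values, and either one forces the rest of the square.\<close>

lemma K33_coloring_cases:
  assumes c: "c \<in> proper_3_edge_colorings K33_edges"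
  shows "(latin 1, c) \<in> recoloring K33_edges \<or> (latin 2, c) \<in> recoloring K33_edges"
proof -
  have rng: "c {i, j} \<in> {1,2,3}" if "i < 3" "3 \<le> j" "j < 6" for i j
    using proper_coloringD(1)[OF c K33_edgeI[OF that]] .
  have row: "c {i, j} \<noteq> c {i, j'}" if "i < 3" "3 \<le> j" "j < 6" "3 \<le> j'" "j' < 6" "j \<noteq> j'" for i j j'
    using that by (intro proper_coloringD(3)[OF c] K33_edgeI) (auto simp: doubleton_eq_iff)
  have col: "c {i, j} \<noteq> c {i', j}" if "i < 3" "i' < 3" "3 \<le> j" "j < 6" "i \<noteq> i'" for i i' j
    using that by (intro proper_coloringD(3)[OF c] K33_edgeI) (auto simp: doubleton_eq_iff)
  have r0: "c {0,3} \<noteq> c {0,4}" "c {0,3} \<noteq> c {0,5}" "c {0,4} \<noteq> c {0,5}"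
    by (rule row; simp)+
  have r1: "c {1,3} \<noteq> c {1,4}" "c {1,3} \<noteq> c {1,5}" "c {1,4} \<noteq> c {1,5}"
    by (rule row; simp)+
  have c3: "c {1,3} \<noteq> c {0,3}" "c {2,3} \<noteq> c {0,3}" "c {2,3} \<noteq> c {1,3}"
    by (rule col; simp)+
  have c4: "c {1,4} \<noteq> c {0,4}" "c {2,4} \<noteq> c {0,4}" "c {2,4} \<noteq> c {1,4}"
    by (rule col; simp)+
  have c5: "c {1,5} \<noteq> c {0,5}" "c {2,5} \<noteq> c {0,5}" "c {2,5} \<noteq> c {1,5}"
    by (rule col; simp)+
  have R0: "c {0,3} \<in> {1,2,3}" "c {0,4} \<in> {1,2,3}" "c {0,5} \<in> {1,2,3}"
    by (rule rng; simp)+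
  have R: "c {1,3} \<in> {1,2,3}" "c {1,4} \<in> {1,2,3}" "c {1,5} \<in> {1,2,3}"
    "c {2,3} \<in> {1,2,3}" "c {2,4} \<in> {1,2,3}" "c {2,5} \<in> {1,2,3}"
    by (rule rng; simp)+
  note third = third_color[OF R0(1,2,3) _ r0(1,2,3)] third_color[OF R0(1,3,2) _ r0(2,1) r0(3)[symmetric]]
    third_color[OF R0(2,3,1) _ r0(3) r0(1,2)[symmetric]]
  have rec: "(latin s, c) \<in> recoloring K33_edges"
    if s: "s = 1 \<or> s = 2" and "\<pi> permutes {1,2,3}" "\<And>e. e \<in> K33_edges \<Longrightarrow> c e = \<pi> (latin s e)" for s \<pi>
  proof -
    have "\<pi> 0 = 0" using that(2) by (rule permutes_not_in) auto
    then have "c = \<pi> \<circ> latin s"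
      using that(3) proper_coloringD(2)[OF c] by (auto simp: fun_eq_iff latin_def)
    then show ?thesis
      using c latin_proper[OF s] that(2) unfolding recoloring_def by blast
  qed
  consider "c {1,3} = c {0,4}" | "c {1,3} = c {0,5}"
    using third(1)[OF R(1)] c3 by blast
  then show ?thesis
  proof cases
    case 1
    have "c {1,5} = c {0,3}" using r1 c5 1 by (intro third(3) R) auto
    moreover from this have "c {1,4} = c {0,5}" using r1 c4 1 by (intro third(1) R) auto
    moreover have "c {2,3} = c {0,5}" using c3 1 by (intro third(1) R) auto
    moreover have "c {2,4} = c {0,3}" using c4 calculation by (intro third(3) R) auto
    moreover have "c {2,5} = c {0,4}" using c5 calculation by (intro third(2) R) auto
    moreover obtain \<pi> where \<pi>: "\<pi> permutes {1,2,3}" "\<pi> 1 = c {0,3}" "\<pi> 2 = c {0,4}" "\<pi> 3 = c {0,5}"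
      using permutation_of_three[OF R0 r0] by blast
    ultimately have "c e = \<pi> (latin 1 e)" if "e \<in> K33_edges" for e
      using that 1 unfolding K33_edges_eq
      by (elim insertE emptyE) (simp_all add: latin_simps del: One_nat_def)
    then show ?thesis using rec \<pi> by blast
  next
    case 2
    have "c {1,4} = c {0,3}" using r1 c4 2 by (intro third(3) R) auto
    moreover from this have "c {1,5} = c {0,4}" using r1 c5 2 by (intro third(2) R) auto
    moreover have "c {2,3} = c {0,4}" using c3 2 by (intro third(2) R) auto
    moreover have "c {2,4} = c {0,5}" using c4 calculation by (intro third(1) R) auto
    moreover have "c {2,5} = c {0,3}" using c5 calculation by (intro third(3) R) auto
    \<comment> \<open>Row \<open>0\<close> of \<open>latin 2\<close> reads 1, 3, 2, which is why
      \<open>c {0,4}\<close> and \<open>c {0,5}\<close> change places compared with the first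
      case.\<close>
    moreover obtain \<pi> where \<pi>: "\<pi> permutes {1,2,3}" "\<pi> 1 = c {0,3}" "\<pi> 2 = c {0,5}" "\<pi> 3 = c {0,4}"
      using permutation_of_three[OF R0(1,3,2) r0(2,1) r0(3)[symmetric]] by blast
    ultimately have "c e = \<pi> (latin 2 e)" if "e \<in> K33_edges" for e
      using that 2 unfolding K33_edges_eq
      by (elim insertE emptyE) (simp_all add: latin_simps del: One_nat_def)
    then show ?thesis using rec \<pi> by blast
  qed
qed

lemma K33_two_recoloring_classes: "two_recoloring_classes K33_edges"
  unfolding two_recoloring_classes_def
proof (intro bexI conjI ballI)
  show "(latin 1, latin 2) \<notin> recoloring K33_edges"
  proof
    assume "(latin 1, latin 2) \<in> recoloring K33_edges"
    then obtain \<pi> where "latin 2 = \<pi> \<circ> latin 1" by (auto simp: recoloring_def)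
    \<comment> \<open>These two edges share color 2 under \<open>latin 1\<close> but have colors 3
      and 2 under \<open>latin 2\<close>, so no function of the color relates the two
      squares.\<close>
    then have "latin 2 {0,4} = \<pi> (latin 1 {0,4})" "latin 2 {1,3} = \<pi> (latin 1 {1,3})" by simp_all
    then show False by (simp add: latin_simps del: One_nat_def)
  qed
qed (use K33_coloring_cases latin_proper in auto)

section \<open>Two-colored Hamiltonian cycles of the complete bipartite graph\<close>

lemma ab_reachable_commute: "ab_reachable E c a b \<longleftrightarrow> ab_reachable E c b a"
proof -
  have "ab_edges E c a b = ab_edges E c b a" by (auto simp: ab_edges_def)
  moreover from this have "ab_adj E c a b = ab_adj E c b a" by (simp add: ab_adj_def fun_eq_iff)
  ultimately show ?thesis by (simp add: ab_reachable_def)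
qed

lemma ab_reachable_permuted:
  assumes "inj \<pi>"
  shows "ab_reachable E (\<pi> \<circ> c) (\<pi> a) (\<pi> b) \<longleftrightarrow> ab_reachable E c a b"
proof -
  have "ab_edges E (\<pi> \<circ> c) (\<pi> a) (\<pi> b) = ab_edges E c a b"
    using assms by (simp add: ab_edges_def inj_eq)
  moreover from this have "ab_adj E (\<pi> \<circ> c) (\<pi> a) (\<pi> b) = ab_adj E c a b"
    by (simp add: ab_adj_def fun_eq_iff)
  ultimately show ?thesis by (simp add: ab_reachable_def)
qed

lemma successively_reach:
  "successively R es \<Longrightarrow> f \<in> set es \<Longrightarrow> R\<^sup>*\<^sup>* (hd es) f"
  by (induction es rule: induct_list012) (auto intro: converse_rtranclp_into_rtranclp)

lemma ab_reachable_path: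
  assumes "ab_edges E c a b \<subseteq> set es" "successively (ab_adj E c a b) es"
  shows "ab_reachable E c a b"
  unfolding ab_reachable_def
  using successively_reach[OF assms(2)] assms(1) ab_adj_reach_sym by (meson rtranclp_trans subsetD)

lemma K33_ab_edges:
  "ab_edges K33_edges c a b = set (filter (\<lambda>e. c e = a \<or> c e = b)
     [{0,3}, {0,4}, {0,5}, {1,3}, {1,4}, {1,5}, {2,3}, {2,4}, {2,5}])"
  unfolding ab_edges_def K33_edges_eq set_filter by (simp only: list.set)

text \<open>Each list is the Hamiltonian cycle of one color pair in one square, cut open at a
  vertex; the closing adjacency is unnecessary for connectedness.\<close>

lemma latin_ab_reachable:
  assumes "s = 1 \<or> s = 2" "a \<in> {1,2,3}" "b \<in> {1,2,3}" "a \<noteq> b"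
  shows "ab_reachable K33_edges (latin s) a b"
proof -
  have "ab_reachable K33_edges (latin 1) 1 2"
    by (rule ab_reachable_path[of _ _ _ _ "[{0,3}, {0,4}, {2,4}, {2,5}, {1,5}, {1,3}]"])
      (simp_all add: ab_adj_def K33_ab_edges latin_simps del: One_nat_def)
  moreover have "ab_reachable K33_edges (latin 1) 1 3"
    by (rule ab_reachable_path[of _ _ _ _ "[{0,3}, {0,5}, {1,5}, {1,4}, {2,4}, {2,3}]"])
      (simp_all add: ab_adj_def K33_ab_edges latin_simps del: One_nat_def)
  moreover have "ab_reachable K33_edges (latin 1) 2 3"
    by (rule ab_reachable_path[of _ _ _ _ "[{0,4}, {0,5}, {2,5}, {2,3}, {1,3}, {1,4}]"])
      (simp_all add: ab_adj_def K33_ab_edges latin_simps del: One_nat_def)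
  moreover have "ab_reachable K33_edges (latin 2) 1 2"
    by (rule ab_reachable_path[of _ _ _ _ "[{0,3}, {0,5}, {2,5}, {2,4}, {1,4}, {1,3}]"])
      (simp_all add: ab_adj_def K33_ab_edges latin_simps del: One_nat_def)
  moreover have "ab_reachable K33_edges (latin 2) 1 3"
    by (rule ab_reachable_path[of _ _ _ _ "[{0,3}, {0,4}, {1,4}, {1,5}, {2,5}, {2,3}]"])
      (simp_all add: ab_adj_def K33_ab_edges latin_simps del: One_nat_def)
  moreover have "ab_reachable K33_edges (latin 2) 2 3"
    by (rule ab_reachable_path[of _ _ _ _ "[{0,4}, {0,5}, {1,5}, {1,3}, {2,3}, {2,4}]"])
      (simp_all add: ab_adj_def K33_ab_edges latin_simps del: One_nat_def)
  ultimately show ?thesis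
    using assms
    by (elim disjE insertE emptyE) (simp_all add: ab_reachable_commute[of _ _ 2 1]
        ab_reachable_commute[of _ _ 3 1] ab_reachable_commute[of _ _ 3 2] del: One_nat_def)
qed

text \<open>Renaming leaves two-colored subgraphs unchanged once the color pair is pulled back by
  \<open>inv \<pi>\<close>, so the two Latin squares settle all colorings.\<close>

lemma K33_kempe_tight: "kempe_tight K33_edges"
  unfolding kempe_tight_def
proof (intro ballI impI)
  fix c and a b :: nat
  assume c: "c \<in> proper_3_edge_colorings K33_edges" and ab: "a \<in> {1,2,3}" "b \<in> {1,2,3}" "a \<noteq> b"
  obtain s \<pi> where s: "s = 1 \<or> s = 2" and \<pi>: "\<pi> permutes {1,2,3}" "c = \<pi> \<circ> latin s"
    using K33_coloring_cases[OF c] by (auto simp: recoloring_def)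
  have inv: "\<pi> (inv \<pi> k) = k" for k
    using \<pi> permutes_inverses(1) by fast
  have "inv \<pi> a \<in> {1,2,3}" "inv \<pi> b \<in> {1,2,3}"
    using ab permutes_in_image[OF permutes_inv[OF \<pi>(1)]] by blast+
  moreover have "inv \<pi> a \<noteq> inv \<pi> b"
    using ab inv by metis
  ultimately have "ab_reachable K33_edges (latin s) (inv \<pi> a) (inv \<pi> b)"
    using latin_ab_reachable s by blast
  then show "ab_reachable K33_edges c a b"
    using ab_reachable_permuted[OF permutes_inj[OF \<pi>(1)], of _ "latin s" "inv \<pi> a" "inv \<pi> b"]
    by (simp add: inv \<pi>(2))
qed

subsection \<open>The infinite family\<close>

text \<open>The induction invariant. Its last two conditions yield two Kempe classes by
  \<open>edge_kempe_classes_two\<close>, and in this form each of them passes through the triangle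
  replacement.\<close>

definition rigid_graph :: "nat set \<Rightarrow> nat set set \<Rightarrow> bool" where
  "rigid_graph V E \<longleftrightarrow> simple_graph V E \<and> cubic V E \<and> k_connected 3 V E \<and> \<not> planar V E \<and>
     kempe_tight E \<and> two_recoloring_classes E"

lemma rigid_graph_K33: "rigid_graph {..<6} K33_edges"
  unfolding rigid_graph_def
  by (intro conjI K33_simple K33_cubic K33_three_connected K33_not_planar K33_kempe_tight
      K33_two_recoloring_classes)

lemma cubic_neighbors:
  assumes "simple_graph V E" "cubic V E" "v \<in> V"
  obtains x y z where "x \<noteq> y" "x \<noteq> z" "y \<noteq> z" "{e \<in> E. v \<in> e} = {{v, x}, {v, y}, {v, z}}"
proof -
  obtain e1 e2 e3 where e: "{e \<in> E. v \<in> e} = {e1, e2, e3}" "e1 \<noteq> e2" "e1 \<noteq> e3" "e2 \<noteq> e3"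
  proof -
    have "card {e \<in> E. v \<in> e} = 3"
      using assms(2,3) by (simp add: cubic_def degree_def)
    then show thesis
      unfolding card_3_iff by (elim exE conjE) (rule that)
  qed
  have "\<exists>u. e = {v, u}" if "e \<in> {e1, e2, e3}" for e
  proof -
    have "e \<in> E" "v \<in> e" using that e(1) by blast+
    moreover from this have "card e = 2" using assms(1) by (simp add: simple_graph_def)
    ultimately show ?thesis by (auto simp: card_2_iff insert_commute)
  qed
  then obtain x y z where "e1 = {v, x}" "e2 = {v, y}" "e3 = {v, z}"
    by (metis insert_iff)
  then show thesis using e by (intro that[of x y z]) auto
qed

lemma rigid_graph_expand:
  assumes G: "rigid_graph V E"
  shows "\<exists>V' E'. rigid_graph V' E' \<and> card V' = card V + 2"
proof -
  have simple: "simple_graph V E" and "cubic V E" and "k_connected 3 V E"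
    using G by (simp_all add: rigid_graph_def)
  then have "finite V" "V \<noteq> {}" by (auto simp: simple_graph_def k_connected_def)
  then obtain v where "v \<in> V" by blast
  obtain x y z where xyz: "x \<noteq> y" "x \<noteq> z" "y \<noteq> z" "{e \<in> E. v \<in> e} = {{v, x}, {v, y}, {v, z}}"
    using cubic_neighbors[OF simple \<open>cubic V E\<close> \<open>v \<in> V\<close>] .
  obtain p where p: "p \<notin> V" using ex_new_if_finite[OF infinite_UNIV_nat \<open>finite V\<close>] by blast
  obtain q where q: "q \<notin> insert p V" using ex_new_if_finite[OF infinite_UNIV_nat, of "insert p V"] \<open>finite V\<close> by blast
  let ?E0 = "{e \<in> E. v \<notin> e}"
  let ?E' = "?E0 \<union> {{v, x}, {p, y}, {q, z}} \<union> {{v, p}, {v, q}, {p, q}}"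
  have "E = ?E0 \<union> {{v, x}, {v, y}, {v, z}}"
    unfolding xyz(4)[symmetric] by blast
  then interpret triangle_expansion V ?E0 v x y z p q E ?E'
    using simple xyz p q by unfold_locales auto
  have "rigid_graph (insert p (insert q V)) ?E'"
    unfolding rigid_graph_def
    using G simple_expansion cubic_expansion three_connected_expansion planar_contract
      kempe_tight_expansion two_recoloring_classes_expansion
    by (auto simp only: rigid_graph_def)
  then show ?thesis using card_expansion by blast
qed

lemma rigid_graph_exists: "\<exists>V E. rigid_graph V E \<and> card V = 6 + 2 * k"
proof (induction k)
  case 0
  show ?case using rigid_graph_K33 by (intro exI[of _ "{..<6}"] exI[of _ K33_edges]) simp
next
  case (Suc k)
  then obtain V E where "rigid_graph V E" "card V = 6 + 2 * k" by blast
  then show ?case using rigid_graph_expand[of V E] by (metis add.assoc add.commute mult_Suc_right)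
qed

theorem theorem19:
  fixes n :: nat
  assumes "even n" and "n \<ge> 8"
  shows "\<exists>(V :: nat set) (E :: nat set set).
           simple_graph V E \<and> card V = n \<and> cubic V E \<and> k_connected 3 V E \<and>
           \<not> planar V E \<and> edge_kempe_classes E = 2"
proof -
  obtain m where "n = 2 * m"
    using assms by blast
  \<comment> \<open>The family starts at six vertices; \<open>n \<ge> 8\<close> gives
    \<open>m \<ge> 4\<close>, so the truncated subtraction is exact.\<close>
  then have "n = 6 + 2 * (m - 3)"
    using assms by simp
  then obtain V E where "rigid_graph V E" "card V = n"
    using rigid_graph_exists[of "m - 3"] by blast
  then show ?thesis
    using edge_kempe_classes_two[of E] unfolding rigid_graph_def by blast
qed

end
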